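(* Let $D$ be a one-ended locally finite hyperbolic digraph that satisfies (B1) and (B2) and that has a finite base. Then the quasi-geodesic boundary $\partial D$ has either a unique or infinitely many elements.
   Context: Digraphs may have loops, parallel edges and oppositely oriented edges. A directed path in $D$ is a sequence $x_0\ldots x_n$ of vertices with every $x_ix_{i+1}$ an edge; its length $\ell$ is $n$. $d(x,y)$ is the length of a shortest directed path from $x$ to $y$, or $\infty$ if there is none. A directed path from $x$ to $y$ is a geodesic if its length is $d(x,y)$. $D$ is locally finite if for every $x$ there are only finitely many $y$ with $d(x,y)=1$ or $d(y,x)=1$. $\mathcal B^+_r(x)=\{y: d(x,y)\le r\}$, $\mathcal B^-_r(x)=\{y:d(y,x)\le r\}$, and $\mathcal B^\pm_r(Y)=\bigcup_{y\in Y}\mathcal B^\pm_r(y)$. A set $S\subseteq V(D)$ is a base if for every vertex $x$ there is $s\in S$ with $\min\{d(x,s),d(s,x)\}<\infty$. A geodesic triangle consists of three points and three geodesics (its sides), one between every two of these points (in one of the two directions). It is $\delta$-thin if for every labelling $P,Q,R$ of its sides such that the starting point of $P$ is the starting or the end point of $Q$ and the end point of $P$ is the starting or the end point of $R$, we have $P\subseteq\mathcal B^+_\delta(Q)\cup\mathcal B^-_\delta(R)$. $D$ is hyperbolic if for some $\delta\ge0$ all geodesic triangles are $\delta$-thin. (B1): there is $f\colon\mathbb R\to\mathbb R$ such that for all $x$, $r\ge0$ and $y,z\in\mathcal B^+_r(x)$, $d(y,z)$ is either $\infty$ or at most $f(r)$. (B2): the same with $\mathcal B^-_r(x)$ in place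 of $\mathcal B^+_r(x)$. A ray is a sequence $x_0x_1\ldots$ of distinct vertices with edges $x_ix_{i+1}$; an anti-ray is such a sequence with edges $x_{i+1}x_i$. For rays or anti-rays write $R_1\preccurlyeq R_2$ if there are infinitely many pairwise disjoint directed paths from $R_1$ to $R_2$; $R_1\sim R_2$ means $R_1\preccurlyeq R_2\preccurlyeq R_1$. The ends of $D$ are the classes of the equivalence relation $\sim$ on all rays and anti-rays; $D$ is one-ended if it has exactly one end. A directed path $P$ is a $(\gamma,c)$-quasi-geodesic if $\ell(uPv)\le\gamma d(u,v)+c$ for every directed subpath $uPv$ of $P$; a (anti-)ray is quasi-geodesic if for some $\gamma\ge1,c\ge0$ all its finite directed subpaths are $(\gamma,c)$-quasi-geodesics. For quasi-geodesic rays or anti-rays write $R_1\le R_2$ if there is $M\ge0$ such that for every $r\ge0$ and every $x$ there is a directed path from $R_1$ to $R_2$ of length at most $M$ outside of $\mathcal B^+_r(x)\cup\mathcal B^-_r(x)$; $R_1\approx R_2$ means $R_1\le R_2\le R_1$, an equivalence relation under the hypotheses. $\partial D$ is the set of its classes. *)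

theory Defs
  imports
    "Graph_Theory.Vertex_Walk"
    "HOL-Library.Extended_Real"
    "HOL-Library.Multiset"
    "HOL-Library.Sublist"
begin

text \<open>
  A directed path is a nonempty list of vertices with consecutive ones joined by an edge, not
  necessarily without repetitions; this is \<^term>\<open>vwalk\<close>, and its length
  \<^term>\<open>vwalk_length\<close> is the number of its edges.
\<close>

definition dpath :: "('a,'b) pre_digraph \<Rightarrow> 'a \<Rightarrow> 'a list \<Rightarrow> 'a \<Rightarrow> bool" where
  "dpath D x P y \<longleftrightarrow> vwalk P D \<and> hd P = x \<and> last P = y"

definition ddist :: "('a,'b) pre_digraph \<Rightarrow> 'a \<Rightarrow> 'a \<Rightarrow> ereal" where
  "ddist D x y = (INF P \<in> {P. dpath D x P y}. ereal (real (vwalk_length P)))"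

definition geodesic :: "('a,'b) pre_digraph \<Rightarrow> 'a \<Rightarrow> 'a list \<Rightarrow> 'a \<Rightarrow> bool" where
  "geodesic D x P y \<longleftrightarrow> dpath D x P y \<and> ereal (real (vwalk_length P)) = ddist D x y"

definition locally_finite :: "('a,'b) pre_digraph \<Rightarrow> bool" where
  "locally_finite D \<longleftrightarrow>
     (\<forall>x \<in> verts D. finite {y \<in> verts D. ddist D x y = 1 \<or> ddist D y x = 1})"

definition out_ball :: "('a,'b) pre_digraph \<Rightarrow> real \<Rightarrow> 'a \<Rightarrow> 'a set" where
  "out_ball D r x = {y \<in> verts D. ddist D x y \<le> ereal r}"

definition in_ball :: "('a,'b) pre_digraph \<Rightarrow> real \<Rightarrow> 'a \<Rightarrow> 'a set" where
  "in_ball D r x = {y \<in> verts D. ddist D y x \<le> ereal r}"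

definition is_base :: "('a,'b) pre_digraph \<Rightarrow> 'a set \<Rightarrow> bool" where
  "is_base D S \<longleftrightarrow> S \<subseteq> verts D \<and>
     (\<forall>x \<in> verts D. \<exists>s \<in> S. min (ddist D x s) (ddist D s x) < \<infinity>)"

text \<open>
  The three points of a triangle may coincide. This does not affect hyperbolicity: in a triangle
  with one trivial side, a side of length at least 2 can be split at its edge next to the doubled
  point, and the resulting nondegenerate triangle gives thinness with \<open>\<delta>\<close> increased by 1.
\<close>

definition geodesic_triangle ::
    "('a,'b) pre_digraph \<Rightarrow> 'a \<Rightarrow> 'a \<Rightarrow> 'a \<Rightarrow> 'a list \<Rightarrow> 'a list \<Rightarrow> 'a list \<Rightarrow> bool" where
  "geodesic_triangle D x y z A B C \<longleftrightarrow>
     x \<in> verts D \<and> y \<in> verts D \<and> z \<in> verts D \<and>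
     (geodesic D x A y \<or> geodesic D y A x) \<and>
     (geodesic D y B z \<or> geodesic D z B y) \<and>
     (geodesic D z C x \<or> geodesic D x C z)"

definition thin_sides ::
    "('a,'b) pre_digraph \<Rightarrow> real \<Rightarrow> 'a list \<Rightarrow> 'a list \<Rightarrow> 'a list \<Rightarrow> bool" where
  "thin_sides D \<delta> A B C \<longleftrightarrow>
     (\<forall>P Q R. mset [P, Q, R] = mset [A, B, C] \<and>
        hd P \<in> {hd Q, last Q} \<and> last P \<in> {hd R, last R} \<longrightarrow>
        set P \<subseteq> (\<Union>q \<in> set Q. out_ball D \<delta> q) \<union> (\<Union>r \<in> set R. in_ball D \<delta> r))"

definition hyperbolic :: "('a,'b) pre_digraph \<Rightarrow> bool" where
  "hyperbolic D \<longleftrightarrow>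
     (\<exists>\<delta>\<ge>0. \<forall>x y z A B C. geodesic_triangle D x y z A B C \<longrightarrow> thin_sides D \<delta> A B C)"

definition B1 :: "('a,'b) pre_digraph \<Rightarrow> bool" where
  "B1 D \<longleftrightarrow> (\<exists>f :: real \<Rightarrow> real. \<forall>x \<in> verts D. \<forall>r\<ge>0. \<forall>y \<in> out_ball D r x. \<forall>z \<in> out_ball D r x.
     ddist D y z = \<infinity> \<or> ddist D y z \<le> ereal (f r))"

definition B2 :: "('a,'b) pre_digraph \<Rightarrow> bool" where
  "B2 D \<longleftrightarrow> (\<exists>f :: real \<Rightarrow> real. \<forall>x \<in> verts D. \<forall>r\<ge>0. \<forall>y \<in> in_ball D r x. \<forall>z \<in> in_ball D r x.
     ddist D y z = \<infinity> \<or> ddist D y z \<le> ereal (f r))"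

definition is_ray :: "('a,'b) pre_digraph \<Rightarrow> (nat \<Rightarrow> 'a) \<Rightarrow> bool" where
  "is_ray D R \<longleftrightarrow> inj R \<and> (\<forall>i. (R i, R (Suc i)) \<in> arcs_ends D)"

definition is_antiray :: "('a,'b) pre_digraph \<Rightarrow> (nat \<Rightarrow> 'a) \<Rightarrow> bool" where
  "is_antiray D R \<longleftrightarrow> inj R \<and> (\<forall>i. (R (Suc i), R i) \<in> arcs_ends D)"

definition rays :: "('a,'b) pre_digraph \<Rightarrow> (nat \<Rightarrow> 'a) set" where
  "rays D = {R. is_ray D R \<or> is_antiray D R}"

definition path_between ::
    "('a,'b) pre_digraph \<Rightarrow> (nat \<Rightarrow> 'a) \<Rightarrow> 'a list \<Rightarrow> (nat \<Rightarrow> 'a) \<Rightarrow> bool" where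
  "path_between D R1 P R2 \<longleftrightarrow> (\<exists>u \<in> range R1. \<exists>v \<in> range R2. dpath D u P v)"

definition end_le :: "('a,'b) pre_digraph \<Rightarrow> (nat \<Rightarrow> 'a) \<Rightarrow> (nat \<Rightarrow> 'a) \<Rightarrow> bool" where
  "end_le D R1 R2 \<longleftrightarrow> (\<exists>\<P>. infinite \<P> \<and> (\<forall>P \<in> \<P>. path_between D R1 P R2) \<and>
     pairwise (\<lambda>P Q. disjnt (set P) (set Q)) \<P>)"

definition end_rel :: "('a,'b) pre_digraph \<Rightarrow> ((nat \<Rightarrow> 'a) \<times> (nat \<Rightarrow> 'a)) set" where
  "end_rel D = {(R1, R2) \<in> rays D \<times> rays D. end_le D R1 R2 \<and> end_le D R2 R1}"

definition ends :: "('a,'b) pre_digraph \<Rightarrow> (nat \<Rightarrow> 'a) set set" where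
  "ends D = rays D // end_rel D"

definition one_ended :: "('a,'b) pre_digraph \<Rightarrow> bool" where
  "one_ended D \<longleftrightarrow> is_singleton (ends D)"

definition quasi_geodesic :: "('a,'b) pre_digraph \<Rightarrow> real \<Rightarrow> real \<Rightarrow> 'a list \<Rightarrow> bool" where
  "quasi_geodesic D \<gamma> c P \<longleftrightarrow> vwalk P D \<and>
     (\<forall>Q. sublist Q P \<and> Q \<noteq> [] \<longrightarrow>
        ereal (real (vwalk_length Q)) \<le> ereal \<gamma> * ddist D (hd Q) (last Q) + ereal c)"

text \<open>
  A sequence that is both a ray and an anti-ray counts if it is quasi-geodesic in one of its two
  roles; the relations below depend only on its vertex set.
\<close>

definition qg_rays :: "('a,'b) pre_digraph \<Rightarrow> (nat \<Rightarrow> 'a) set" where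
  "qg_rays D = {R.
     (is_ray D R \<and> (\<exists>\<gamma>\<ge>1. \<exists>c\<ge>0. \<forall>i j. i \<le> j \<longrightarrow> quasi_geodesic D \<gamma> c (map R [i..<Suc j]))) \<or>
     (is_antiray D R \<and>
        (\<exists>\<gamma>\<ge>1. \<exists>c\<ge>0. \<forall>i j. i \<le> j \<longrightarrow> quasi_geodesic D \<gamma> c (rev (map R [i..<Suc j]))))}"

definition qg_le :: "('a,'b) pre_digraph \<Rightarrow> (nat \<Rightarrow> 'a) \<Rightarrow> (nat \<Rightarrow> 'a) \<Rightarrow> bool" where
  "qg_le D R1 R2 \<longleftrightarrow> (\<exists>M::real. M \<ge> 0 \<and> (\<forall>r\<ge>0. \<forall>x \<in> verts D.
     \<exists>P. path_between D R1 P R2 \<and> real (vwalk_length P) \<le> M \<and>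
         set P \<inter> (out_ball D r x \<union> in_ball D r x) = {}))"

definition qg_rel :: "('a,'b) pre_digraph \<Rightarrow> ((nat \<Rightarrow> 'a) \<times> (nat \<Rightarrow> 'a)) set" where
  "qg_rel D = {(R1, R2) \<in> qg_rays D \<times> qg_rays D. qg_le D R1 R2 \<and> qg_le D R2 R1}"

definition qg_boundary :: "('a,'b) pre_digraph \<Rightarrow> (nat \<Rightarrow> 'a) set set" where
  "qg_boundary D = qg_rays D // qg_rel D"

end

theory Submission
  imports Defs "HOL-Library.Infinite_Set"
begin

text \<open>
  In an undirected hyperbolic graph with one end the boundary is connected, and a finite boundary is
  discrete, so it is a single point. The proof is a discrete version of this argument. Assume that
  the boundary is finite and let \<open>R1\<close> and \<open>R2\<close> be quasi-geodesic rays or anti-rays; the aim is to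
  show that they are equivalent.

  After reversing all edges if necessary, one of them is a ray, say \<open>R1\<close>. Choose \<open>x\<close> on \<open>R1\<close>. All
  paths from \<open>R1\<close> to \<open>R2\<close> that matter lie in the part of the digraph that is reachable from \<open>x\<close>, and
  there the distance from \<open>x\<close> is a level function. The main obstacle is that distances are not
  symmetric. It is overcome by \<open>level_step\<close>: thin triangles and (B2) imply that this level
  drops by at most a constant along an edge. Dually, (B1) controls the distance to a fixed vertex.
  It follows that two geodesics from \<open>x\<close> whose ends are joined by a short path fellow travel, up to
  shortly before their ends, with a constant that is independent of the ends (\<open>fellow_if_ends_near\<close>),
  and that geodesics are near quasi-geodesics with the same ends (\<open>geodesic_near_quasi_geodesic\<close>).

  By local finiteness, geodesics from \<open>x\<close> to the vertices of \<open>R1\<close> and \<open>R2\<close> subconverge to geodesic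
  rays \<open>G1\<close> and \<open>G2\<close> (\<open>koenig\<close>), and paths of bounded length lead from \<open>R1\<close> to \<open>G1\<close>
  and back, and likewise for \<open>R2\<close> and \<open>G2\<close> (\<open>qg_ray_tracks_limit\<close>, \<open>qg_antiray_tracks_limit\<close>). It
  remains to show that \<open>G1\<close> and \<open>G2\<close> fellow travel.

  Since the boundary is finite, there are finitely many geodesic rays from \<open>x\<close> such that every
  geodesic ray from \<open>x\<close> fellow travels exactly one of them. For a large level \<open>N\<close>, colour a far vertex
  \<open>v\<close> by the ray \<open>H\<close> among them that fellow travels a geodesic from \<open>x\<close> to \<open>v\<close> up to level \<open>N\<close>. Every
  far vertex has a colour (\<open>far_vertices_coloured\<close>), and adjacent far vertices have the same colour
  (\<open>colour_unique\<close>), since the chosen rays are far apart at level \<open>N\<close>. One-endedness yields a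
  path from \<open>R1\<close> to \<open>R2\<close> outside of any given finite set, and the colour is constant along this path
  and along the tails of \<open>R1\<close> and \<open>R2\<close>, where it is determined by \<open>G1\<close> and \<open>G2\<close>
  (\<open>linked_imp_same_limit\<close>).
\<close>

section \<open>Distances and geodesics of a relation\<close>

text \<open>Working with a bare relation instead of a digraph makes reversal of all edges the plain
converse \<open>E\<inverse>\<close>, and the hypotheses of the theorem are invariant under it. Hence each
statement about thin digraphs has a mirror image, obtained by instantiation.\<close>
definition near :: "('a \<times> 'a) set \<Rightarrow> nat \<Rightarrow> 'a \<Rightarrow> 'a \<Rightarrow> bool" where
  "near E k x y \<longleftrightarrow> (\<exists>m\<le>k. (x, y) \<in> E ^^ m)"

text \<open>The value is arbitrary if \<open>y\<close> cannot be reached from \<open>x\<close>; every use carries reachability along.\<close>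
definition gdist :: "('a \<times> 'a) set \<Rightarrow> 'a \<Rightarrow> 'a \<Rightarrow> nat" where
  "gdist E x y = (LEAST n. (x, y) \<in> E ^^ n)"

text \<open>The union of all geodesics from \<open>x\<close> to \<open>y\<close>. Most of the geometry only needs to know that a point
lies on some geodesic, and intervals restrict to subintervals without any bookkeeping of indices.\<close>
definition interval :: "('a \<times> 'a) set \<Rightarrow> 'a \<Rightarrow> 'a \<Rightarrow> 'a set" where
  "interval E x y = {a. (x, a) \<in> E\<^sup>* \<and> (a, y) \<in> E\<^sup>* \<and> gdist E x a + gdist E a y = gdist E x y}"

text \<open>Vertex sets of geodesics: thinness mentions no more than the vertices of the sides, and
these sets do not change when the edges are reversed.\<close>
definition geo :: "('a \<times> 'a) set \<Rightarrow> 'a \<Rightarrow> 'a \<Rightarrow> 'a set \<Rightarrow> bool" where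
  "geo E x y A \<longleftrightarrow> (\<exists>g. g 0 = x \<and> g (gdist E x y) = y \<and>
     (\<forall>i < gdist E x y. (g i, g (Suc i)) \<in> E) \<and> A = g ` {..gdist E x y})"

lemma converse_relpow_eq: "((E :: ('a \<times> 'a) set)\<inverse>) ^^ n = (E ^^ n)\<inverse>"
proof (induction n)
  case (Suc n)
  have "(E\<inverse>) ^^ Suc n = (E ^^ n)\<inverse> O E\<inverse>"
    using Suc by simp
  also have "\<dots> = (E O E ^^ n)\<inverse>"
    by (rule converse_relcomp[symmetric])
  also have "E O E ^^ n = E ^^ Suc n"
    by (simp add: relpow_commute)
  finally show ?case .
qed simp

lemma near_converse: "near (E\<inverse>) k x y \<longleftrightarrow> near E k y x"
  by (simp add: near_def converse_relpow_eq)

lemma gdist_converse: "gdist (E\<inverse>) x y = gdist E y x"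
  by (simp add: gdist_def converse_relpow_eq)

lemma interval_converse: "interval (E\<inverse>) x y = interval E y x"
  by (auto simp: interval_def gdist_converse rtrancl_converse)

lemma geo_converse_imp:
  assumes "geo (E\<inverse>) x y A" shows "geo E y x A"
proof -
  let ?n = "gdist E y x"
  obtain g where g: "g 0 = x" "g ?n = y" "\<And>i. i < ?n \<Longrightarrow> (g (Suc i), g i) \<in> E" "A = g ` {..?n}"
    using assms by (auto simp: geo_def gdist_converse)
  have "(g (?n - i), g (?n - Suc i)) \<in> E" if "i < ?n" for i
    using g(3)[of "?n - Suc i"] that by (simp add: Suc_diff_Suc)
  moreover have "A = (\<lambda>i. g (?n - i)) ` {..?n}"
  proof -
    have "j \<in> (\<lambda>i. ?n - i) ` {..?n}" if "j \<le> ?n" for j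
      using that by (intro image_eqI[of _ _ "?n - j"]) auto
    then have "(\<lambda>i. ?n - i) ` {..?n} = {..?n}"
      by auto
    then have "g ` (\<lambda>i. ?n - i) ` {..?n} = A"
      using g(4) by simp
    then show ?thesis
      by (simp add: image_image)
  qed
  ultimately show ?thesis
    using g(1,2) by (auto simp: geo_def intro!: exI[of _ "\<lambda>i. g (?n - i)"])
qed

lemma geo_converse: "geo (E\<inverse>) x y A \<longleftrightarrow> geo E y x A"
  using geo_converse_imp[of E x y A] geo_converse_imp[of "E\<inverse>" y x A] by auto

lemma near_imp_reach: "near E k x y \<Longrightarrow> (x, y) \<in> E\<^sup>*"
  by (auto simp: near_def relpow_imp_rtrancl)

lemma near_mono: "near E k x y \<Longrightarrow> k \<le> l \<Longrightarrow> near E l x y"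
  by (auto simp: near_def intro: order_trans)

lemma near_trans: "near E k x y \<Longrightarrow> near E l y z \<Longrightarrow> near E (k + l) x z"
  unfolding near_def by (metis add_mono relpow_add relcompI)

lemma near_refl [simp]: "near E k x x"
  by (auto simp: near_def intro: exI[of _ 0])

lemma near_edge: "(x, y) \<in> E \<Longrightarrow> near E (Suc 0) x y"
  unfolding near_def by (intro exI[of _ "Suc 0"]) simp

lemma gdist_relpow: "(x, y) \<in> E\<^sup>* \<Longrightarrow> (x, y) \<in> E ^^ gdist E x y"
  unfolding gdist_def by (meson LeastI rtrancl_imp_relpow)

lemma gdist_le: "(x, y) \<in> E ^^ n \<Longrightarrow> gdist E x y \<le> n"
  unfolding gdist_def by (rule Least_le)

lemma near_iff: "near E k x y \<longleftrightarrow> (x, y) \<in> E\<^sup>* \<and> gdist E x y \<le> k"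
  using gdist_le gdist_relpow near_imp_reach unfolding near_def by (metis order_trans)

lemma gdist_self [simp]: "gdist E x x = 0"
  using gdist_le[of x x 0 E] by simp

lemma gdist_eq_0D: "(x, y) \<in> E\<^sup>* \<Longrightarrow> gdist E x y = 0 \<Longrightarrow> x = y"
  by (metis gdist_relpow relpow_0_E)

lemma gdist_triangle:
  "(x, y) \<in> E\<^sup>* \<Longrightarrow> (y, z) \<in> E\<^sup>* \<Longrightarrow> gdist E x z \<le> gdist E x y + gdist E y z"
  using near_trans[of E "gdist E x y" x y "gdist E y z" z] by (simp add: near_iff)

lemma near_walk:
  assumes "\<And>l. i \<le> l \<Longrightarrow> l < j \<Longrightarrow> (w l, w (Suc l)) \<in> E" "i \<le> j"
  shows "near E (j - i) (w i) (w j)"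
  using assms(2,1)
proof (induction j rule: dec_induct)
  case (step n)
  then have "near E (n - i) (w i) (w n)" and "near E 1 (w n) (w (Suc n))"
    by (auto intro: near_edge)
  from near_trans[OF this] show ?case
    using step(1) by (simp add: Suc_diff_le)
qed simp

lemma intervalD:
  assumes "a \<in> interval E x y"
  shows "(x, a) \<in> E\<^sup>*" "(a, y) \<in> E\<^sup>*" "(x, y) \<in> E\<^sup>*" "gdist E x a + gdist E a y = gdist E x y"
  using assms rtrancl_trans[of x a E y] by (simp_all add: interval_def)

lemma interval_ends:
  "(x, y) \<in> E\<^sup>* \<Longrightarrow> x \<in> interval E x y" "(x, y) \<in> E\<^sup>* \<Longrightarrow> y \<in> interval E x y"
  by (auto simp: interval_def)

lemma interval_self [simp]: "interval E x x = {x}"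
  by (auto simp: interval_def dest: gdist_eq_0D)

lemma relpow_walk: "(x, y) \<in> E ^^ n \<Longrightarrow> \<exists>g. g 0 = x \<and> g n = y \<and> (\<forall>i<n. (g i, g (Suc i)) \<in> E)"
  by (simp add: relpow_fun_conv)

lemma geo_param:
  assumes "geo E x y A"
  obtains g n where "n = gdist E x y" "g 0 = x" "g n = y" "A = g ` {..n}"
    "\<And>i j. i \<le> j \<Longrightarrow> j \<le> n \<Longrightarrow> (g i, g j) \<in> E\<^sup>*"
    "\<And>i j. i \<le> j \<Longrightarrow> j \<le> n \<Longrightarrow> gdist E (g i) (g j) = j - i"
proof -
  obtain g n where n: "n = gdist E x y"
    and g: "g 0 = x" "g n = y" "A = g ` {..n}" "\<And>i. i < n \<Longrightarrow> (g i, g (Suc i)) \<in> E"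
    using assms unfolding geo_def by blast
  have near: "near E (j - i) (g i) (g j)" if "i \<le> j" "j \<le> n" for i j
    using g(4) that by (intro near_walk) auto
  have reach: "(g i, g j) \<in> E\<^sup>*" if "i \<le> j" "j \<le> n" for i j
    using near[OF that] near_imp_reach by metis
  have "gdist E (g i) (g j) = j - i" if "i \<le> j" "j \<le> n" for i j
  proof -
    have "n \<le> gdist E (g 0) (g i) + (gdist E (g i) (g j) + gdist E (g j) (g n))"
      using gdist_triangle[of "g 0" "g i" E "g n"] gdist_triangle[of "g i" "g j" E "g n"]
        reach[of 0 i] reach[of i j] reach[of j n] reach[of i n] that unfolding g(1,2) n[symmetric]
      by linarith
    then show ?thesis
      using near[of 0 i] near[of i j] near[of j n] that unfolding near_iff by linarith
  qed
  with n g(1-3) reach show thesis by (rule that)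
qed

lemma geo_subset_interval:
  assumes "geo E x y A" shows "A \<subseteq> interval E x y"
proof
  fix a assume "a \<in> A"
  obtain g n where g: "n = gdist E x y" "g 0 = x" "g n = y" "A = g ` {..n}"
    "\<And>i j. i \<le> j \<Longrightarrow> j \<le> n \<Longrightarrow> (g i, g j) \<in> E\<^sup>*"
    "\<And>i j. i \<le> j \<Longrightarrow> j \<le> n \<Longrightarrow> gdist E (g i) (g j) = j - i"
    by (rule geo_param[OF assms]) (rule that)
  obtain i where i: "a = g i" "i \<le> n" using \<open>a \<in> A\<close> g(4) by auto
  have "(x, a) \<in> E\<^sup>*" "(a, y) \<in> E\<^sup>*" "gdist E x a = i" "gdist E a y = n - i"
    using g(5,6)[of 0 i] g(5,6)[of i n] i g(2,3) by auto
  then show "a \<in> interval E x y"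
    using i(2) g(1) by (simp add: interval_def)
qed

lemma geo_ends:
  assumes "geo E x y A" shows "x \<in> A" "y \<in> A"
proof -
  obtain g n where "g 0 = x" "g n = y" "A = g ` {..n::nat}"
    using assms unfolding geo_def by blast
  then show "x \<in> A" "y \<in> A"
    by (metis atMost_iff image_eqI le0, metis atMost_iff image_eqI order_refl)
qed

text \<open>A shortest walk to \<open>a\<close> continued by a shortest walk from \<open>a\<close> is a geodesic, by the definition of
the interval.\<close>
lemma geo_through:
  assumes "a \<in> interval E x y"
  shows "\<exists>A. geo E x y A \<and> a \<in> A"
proof -
  let ?k = "gdist E x a" and ?n = "gdist E x y"
  obtain g where g: "g 0 = x" "g ?k = a" "\<And>i. i < ?k \<Longrightarrow> (g i, g (Suc i)) \<in> E"
    using relpow_walk[OF gdist_relpow[OF intervalD(1)[OF assms]]] by blast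
  obtain h where h: "h 0 = a" "h (?n - ?k) = y" "\<And>i. i < ?n - ?k \<Longrightarrow> (h i, h (Suc i)) \<in> E"
    using relpow_walk[OF gdist_relpow[OF intervalD(2)[OF assms]]] intervalD(4)[OF assms]
    by (metis diff_add_inverse)
  have le: "?k \<le> ?n" using intervalD(4)[OF assms] by simp
  let ?f = "\<lambda>i. if i < ?k then g i else h (i - ?k)"
  have "(?f i, ?f (Suc i)) \<in> E" if "i < ?n" for i
  proof (cases "i < ?k")
    case True
    then have "?f (Suc i) = g (Suc i)"
      using g(2) h(1) by (cases "Suc i = ?k") auto
    then show ?thesis using True g(3) by simp
  next
    case False
    then show ?thesis using h(3)[of "i - ?k"] that by (simp add: Suc_diff_le not_less)
  qed
  moreover have "?f 0 = x" "?f ?n = y" "?f ?k = a"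
    using g h le by (cases "?k = 0"; auto)+
  ultimately have "geo E x y (?f ` {..?n})"
    unfolding geo_def by (intro exI[of _ ?f]) simp
  moreover have "a \<in> ?f ` {..?n}"
    using \<open>?f ?k = a\<close> le by (intro image_eqI[of _ _ ?k]) auto
  ultimately show ?thesis by blast
qed

lemma geo_exists: "(x, y) \<in> E\<^sup>* \<Longrightarrow> \<exists>A. geo E x y A"
  using geo_through interval_ends(1) by metis

lemma interval_point:
  assumes "(x, y) \<in> E\<^sup>*" "k \<le> gdist E x y"
  obtains a where "a \<in> interval E x y" "gdist E x a = k" "gdist E a y = gdist E x y - k"
proof -
  obtain A where A: "geo E x y A" using geo_exists assms(1) by metis
  obtain g n where g: "n = gdist E x y" "g 0 = x" "g n = y" "A = g ` {..n}"
    "\<And>i j. i \<le> j \<Longrightarrow> j \<le> n \<Longrightarrow> (g i, g j) \<in> E\<^sup>*"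
    "\<And>i j. i \<le> j \<Longrightarrow> j \<le> n \<Longrightarrow> gdist E (g i) (g j) = j - i"
    by (rule geo_param[OF A]) (rule that)
  have "g k \<in> interval E x y" "gdist E x (g k) = k" "gdist E (g k) y = n - k"
    using g(6)[of 0 k] g(6)[of k n] g(1-4) assms(2) geo_subset_interval[OF A] by auto
  then show thesis
    using g(1) by (intro that[of "g k"]) simp_all
qed

lemma interval_mono_left: "a \<in> interval E x y \<Longrightarrow> b \<in> interval E a y \<Longrightarrow> b \<in> interval E x y"
  using gdist_triangle[of x a E b] gdist_triangle[of x b E y] rtrancl_trans[of x a E b]
  by (auto simp: interval_def)

lemma interval_mono_right: "a \<in> interval E x y \<Longrightarrow> b \<in> interval E x a \<Longrightarrow> b \<in> interval E x y"
  using interval_mono_left[of a "E\<inverse>" y x b] by (simp add: interval_converse)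

lemma geo_order:
  assumes "geo E x y A" "a \<in> A" "b \<in> A" "gdist E x a \<le> gdist E x b"
  shows "(a, b) \<in> E\<^sup>*" "gdist E a b = gdist E x b - gdist E x a"
proof -
  obtain g n where g: "n = gdist E x y" "g 0 = x" "g n = y" "A = g ` {..n}"
    "\<And>i j. i \<le> j \<Longrightarrow> j \<le> n \<Longrightarrow> (g i, g j) \<in> E\<^sup>*"
    "\<And>i j. i \<le> j \<Longrightarrow> j \<le> n \<Longrightarrow> gdist E (g i) (g j) = j - i"
    by (rule geo_param[OF assms(1)]) (rule that)
  obtain i j where ij: "a = g i" "i \<le> n" "b = g j" "j \<le> n"
    using assms(2,3) g(4) by auto
  have ga: "gdist E x a = i" and gb: "gdist E x b = j"
    using ij g(2) g(6)[of 0 i] g(6)[of 0 j] by auto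
  then have "i \<le> j" using assms(4) by simp
  then show "(a, b) \<in> E\<^sup>*" "gdist E a b = gdist E x b - gdist E x a"
    using ij g(5,6)[of i j] ga gb by auto
qed

lemma geo_reach: "geo E x y A \<Longrightarrow> (x, y) \<in> E\<^sup>*"
  using geo_subset_interval geo_ends(1) intervalD(3) by (metis subsetD)

lemma gdist_near_right: "(x, y) \<in> E\<^sup>* \<Longrightarrow> near E k y z \<Longrightarrow> gdist E x z \<le> gdist E x y + k"
  using gdist_triangle[of x y E z] by (simp add: near_iff)

lemma gdist_near_left: "near E k x y \<Longrightarrow> (y, z) \<in> E\<^sup>* \<Longrightarrow> gdist E x z \<le> k + gdist E y z"
  using gdist_triangle[of x y E z] by (simp add: near_iff)

lemma interval_shorten_left:
  assumes "a \<in> interval E x y" "p \<in> interval E x a"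
  shows "a \<in> interval E p y"
proof -
  have "(p, y) \<in> E\<^sup>*"
    using intervalD(2)[OF assms(1)] intervalD(2)[OF assms(2)] by (rule rtrancl_trans[rotated])
  moreover have "gdist E p a + gdist E a y = gdist E p y"
    using gdist_triangle[of x p E y] gdist_triangle[of p a E y] intervalD[OF assms(1)]
      intervalD[OF assms(2)] \<open>(p, y) \<in> E\<^sup>*\<close> by simp
  ultimately show ?thesis
    using intervalD[OF assms(1)] intervalD[OF assms(2)] by (simp add: interval_def)
qed

lemma interval_shorten_right:
  "a \<in> interval E x y \<Longrightarrow> q \<in> interval E a y \<Longrightarrow> a \<in> interval E x q"
  using interval_shorten_left[of a "E\<inverse>" y x q] by (simp add: interval_converse)

lemma near_interval_left: "a \<in> interval E x y \<Longrightarrow> near E (gdist E x y) x a"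
  using intervalD[of a E x y] by (simp add: near_iff)

lemma near_interval_right: "a \<in> interval E x y \<Longrightarrow> near E (gdist E x y) a y"
  using intervalD[of a E x y] by (simp add: near_iff)

section \<open>Linear against exponential growth\<close>

lemma linear_le_power2: "\<exists>k0. \<forall>k\<ge>k0. a * k + b \<le> (2::nat) ^ k"
proof (intro exI allI impI)
  fix k :: nat assume k: "max 4 (a + b) \<le> k"
  have square: "k * k \<le> 2 ^ k" if "4 \<le> k" for k :: nat
    using that
  proof (induction k rule: dec_induct)
    case (step n)
    have "Suc n * Suc n = n * n + (2 * n + 1)" by simp
    also have "\<dots> \<le> n * n + 4 * n" using step(1) by simp
    also have "\<dots> \<le> n * n + n * n" using step(1) by (intro add_left_mono mult_right_mono) auto
    finally show ?case using step(3) by simp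
  qed simp
  have "a * k + b \<le> (a + b) * k" using k by (simp add: distrib_right)
  also have "\<dots> \<le> k * k" using k by (intro mult_right_mono) auto
  finally show "a * k + b \<le> 2 ^ k" using square[of k] k by simp
qed

text \<open>This turns the estimate of \<open>quasi_geodesic_distance_improves\<close>, which bounds a distance by the
logarithm of a linear function of itself, into a uniform bound.\<close>
lemma bounded_by_log_of_itself:
  "\<exists>M::nat. \<forall>D. (\<forall>k. A * D + B \<le> 2 ^ k \<longrightarrow> D \<le> C + F * k) \<longrightarrow> D \<le> M"
proof -
  define f where "f = Suc F"
  obtain k0 where k0: "\<And>k. k \<ge> k0 \<Longrightarrow> (A * f) * k + (A * (C + f) + B) \<le> 2 ^ k"
    using linear_le_power2 by blast
  have "D \<le> Suc C + f * k0" if D: "\<And>k. A * D + B \<le> 2 ^ k \<Longrightarrow> D \<le> C + F * k" for D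
  proof (rule ccontr)
    assume "\<not> D \<le> Suc C + f * k0"
    define k where "k = (D - Suc C) div f"
    have "f * k0 \<le> D - Suc C" and DC: "Suc C \<le> D"
      using \<open>\<not> D \<le> Suc C + f * k0\<close> by auto
    then have "k0 \<le> k"
      by (simp add: k_def f_def less_eq_div_iff_mult_less_eq mult.commute)
    have "(D - Suc C) mod f < f" by (simp add: f_def)
    then have le: "f * k \<le> D - Suc C" and lt: "D - Suc C < f * k + f"
      unfolding k_def using mult_div_mod_eq[of f "D - Suc C"] by linarith+
    from lt have "D \<le> C + f * k + f" by simp
    then have "A * D + B \<le> (A * f) * k + (A * (C + f) + B)"
      using mult_left_mono[of D "C + f * k + f" A] by (simp add: algebra_simps)
    then have "D \<le> C + F * k" using k0[OF \<open>k0 \<le> k\<close>] D by (meson order_trans)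
    also have "\<dots> \<le> C + f * k" by (simp add: f_def)
    finally show False using le DC by simp
  qed
  then show ?thesis by blast
qed

section \<open>Levels in digraphs with thin triangles\<close>

text \<open>The properties of a hyperbolic digraph that the geometric arguments use. The sides of a
triangle run from \<open>x\<close> to \<open>y\<close>, from \<open>y\<close> to \<open>z\<close> and from \<open>x\<close> to \<open>z\<close>. The last two
assumptions are (B1) and (B2) for the single radius \<open>Suc \<delta>\<close>; bounds for all other radii follow,
and they are even linear in the radius.\<close>
locale thin_digraph =
  fixes E :: "('a \<times> 'a) set" and \<delta> \<beta> :: nat
  assumes thin_first: "\<lbrakk>geo E x y A; geo E y z B; geo E x z C; a \<in> A\<rbrakk> \<Longrightarrow>
      (\<exists>c\<in>C. near E \<delta> c a) \<or> (\<exists>b\<in>B. near E \<delta> a b)"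
    and thin_second: "\<lbrakk>geo E x y A; geo E y z B; geo E x z C; b \<in> B\<rbrakk> \<Longrightarrow>
      (\<exists>a\<in>A. near E \<delta> a b) \<or> (\<exists>c\<in>C. near E \<delta> b c)"
    and thin_long: "\<lbrakk>geo E x y A; geo E y z B; geo E x z C; c \<in> C\<rbrakk> \<Longrightarrow>
      (\<exists>a\<in>A. near E \<delta> a c) \<or> (\<exists>b\<in>B. near E \<delta> c b)"
    and out_bound: "\<lbrakk>near E (Suc \<delta>) x y; near E (Suc \<delta>) x z; (y, z) \<in> E\<^sup>*\<rbrakk> \<Longrightarrow> near E \<beta> y z"
    and in_bound: "\<lbrakk>near E (Suc \<delta>) y x; near E (Suc \<delta>) z x; (y, z) \<in> E\<^sup>*\<rbrakk> \<Longrightarrow> near E \<beta> y z"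
begin

abbreviation reach :: "'a \<Rightarrow> 'a \<Rightarrow> bool" where "reach x y \<equiv> (x, y) \<in> E\<^sup>*"
abbreviation d :: "'a \<Rightarrow> 'a \<Rightarrow> nat" where "d \<equiv> gdist E"
abbreviation I :: "'a \<Rightarrow> 'a \<Rightarrow> 'a set" where "I \<equiv> interval E"
abbreviation nr :: "nat \<Rightarrow> 'a \<Rightarrow> 'a \<Rightarrow> bool" where "nr \<equiv> near E"

text \<open>The amount by which the distance from a fixed vertex can drop along an edge, see \<open>level_step\<close>.\<close>
definition K :: nat where "K = Suc \<delta> + \<beta>"

lemma reversed: "thin_digraph (E\<inverse>) \<delta> \<beta>"
proof
  fix x y z a A B C assume "geo (E\<inverse>) x y A" "geo (E\<inverse>) y z B" "geo (E\<inverse>) x z C" "a \<in> A"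
  then show "(\<exists>c\<in>C. near (E\<inverse>) \<delta> c a) \<or> (\<exists>b\<in>B. near (E\<inverse>) \<delta> a b)"
    using thin_second[of z y B x A C a] by (auto simp: geo_converse near_converse)
next
  fix x y z b A B C assume "geo (E\<inverse>) x y A" "geo (E\<inverse>) y z B" "geo (E\<inverse>) x z C" "b \<in> B"
  then show "(\<exists>a\<in>A. near (E\<inverse>) \<delta> a b) \<or> (\<exists>c\<in>C. near (E\<inverse>) \<delta> b c)"
    using thin_first[of z y B x A C b] by (auto simp: geo_converse near_converse)
next
  fix x y z c A B C assume "geo (E\<inverse>) x y A" "geo (E\<inverse>) y z B" "geo (E\<inverse>) x z C" "c \<in> C"
  then show "(\<exists>a\<in>A. near (E\<inverse>) \<delta> a c) \<or> (\<exists>b\<in>B. near (E\<inverse>) \<delta> c b)"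
    using thin_long[of z y B x A C c] by (auto simp: geo_converse near_converse)
next
  fix x y z assume "near (E\<inverse>) (Suc \<delta>) x y" "near (E\<inverse>) (Suc \<delta>) x z" "(y, z) \<in> (E\<inverse>)\<^sup>*"
  then show "near (E\<inverse>) \<beta> y z"
    using in_bound[of z x y] by (simp add: near_converse rtrancl_converse)
next
  fix x y z assume "near (E\<inverse>) (Suc \<delta>) y x" "near (E\<inverse>) (Suc \<delta>) z x" "(y, z) \<in> (E\<inverse>)\<^sup>*"
  then show "near (E\<inverse>) \<beta> y z"
    using out_bound[of x z y] by (simp add: near_converse rtrancl_converse)
qed

lemma thin_first_interval:
  assumes "a \<in> I x y" "reach y z"
  shows "(\<exists>c\<in>I x z. nr \<delta> c a) \<or> (\<exists>b\<in>I y z. nr \<delta> a b)"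
proof -
  have "reach x z" using intervalD(3)[OF assms(1)] assms(2) by (rule rtrancl_trans)
  obtain A B C where ABC: "geo E x y A" "a \<in> A" "geo E y z B" "geo E x z C"
    using geo_through[OF assms(1)] geo_exists[OF assms(2)] geo_exists[OF \<open>reach x z\<close>] by blast
  from thin_first[OF ABC(1,3,4,2)] show ?thesis
    using geo_subset_interval[OF ABC(3)] geo_subset_interval[OF ABC(4)] by blast
qed

lemma thin_second_interval:
  assumes "b \<in> I y z" "reach x y"
  shows "(\<exists>a\<in>I x y. nr \<delta> a b) \<or> (\<exists>c\<in>I x z. nr \<delta> b c)"
proof -
  have "reach x z" using assms(2) intervalD(3)[OF assms(1)] by (rule rtrancl_trans)
  obtain A B C where ABC: "geo E x y A" "geo E y z B" "b \<in> B" "geo E x z C"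
    using geo_through[OF assms(1)] geo_exists[OF assms(2)] geo_exists[OF \<open>reach x z\<close>] by blast
  from thin_second[OF ABC(1,2,4,3)] show ?thesis
    using geo_subset_interval[OF ABC(1)] geo_subset_interval[OF ABC(4)] by blast
qed

lemma thin_long_interval:
  assumes "c \<in> I x z" "reach x y" "reach y z"
  shows "(\<exists>a\<in>I x y. nr \<delta> a c) \<or> (\<exists>b\<in>I y z. nr \<delta> c b)"
proof -
  obtain A B C where ABC: "geo E x y A" "geo E y z B" "geo E x z C" "c \<in> C"
    using geo_through[OF assms(1)] geo_exists[OF assms(2)] geo_exists[OF assms(3)] by blast
  from thin_long[OF ABC] show ?thesis
    using geo_subset_interval[OF ABC(1)] geo_subset_interval[OF ABC(2)] by blast
qed

text \<open>The key fact: distances from \<open>x\<close> behave as if each edge could be traversed backwards at cost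
\<open>K\<close>, although \<open>u\<close> need not be reachable from \<open>v\<close>. If \<open>u\<close> were much further from \<open>x\<close> than \<open>v\<close>, take
the point \<open>a\<close> on a geodesic to \<open>u\<close> that is just too far away to be near the geodesic
to \<open>v\<close>. Thinness puts \<open>a\<close> close in front of the edge, so \<open>a\<close> and \<open>u\<close> lie in a small in-ball
of \<open>v\<close>, and (B2) bounds the distance from \<open>a\<close> to \<open>u\<close>.\<close>
lemma level_step:
  assumes "reach x u" "(u, v) \<in> E"
  shows "d x u \<le> d x v + K"
proof (rule ccontr)
  assume "\<not> ?thesis"
  then have gt: "d x v + Suc \<delta> + \<beta> < d x u" by (simp add: K_def)
  then obtain a where a: "a \<in> I x u" "d x a = d x v + Suc \<delta>"
    using interval_point[OF assms(1), of "d x v + Suc \<delta>"] by auto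
  have uv: "reach u v" "nr 1 u v" using assms(2) near_edge by auto
  have xv: "reach x v" using assms by (rule rtrancl_into_rtrancl)
  from thin_first_interval[OF a(1) uv(1)] show False
  proof (elim disjE bexE)
    fix c assume c: "c \<in> I x v" "nr \<delta> c a"
    then show False
      using gdist_near_right[OF intervalD(1)[OF c(1)] c(2)] intervalD(4)[OF c(1)] a(2) by simp
  next
    fix b assume b: "b \<in> I u v" "nr \<delta> a b"
    have "nr 1 b v" using near_interval_right[OF b(1)] uv(2) by (auto simp: near_iff)
    then have "nr (Suc \<delta>) a v" using near_trans[OF b(2), of 1 v] by simp
    moreover have "nr (Suc \<delta>) u v" using uv(2) by (rule near_mono) simp
    ultimately have "nr \<beta> a u" using intervalD(2)[OF a(1)] by (rule in_bound)
    then show False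
      using gdist_near_right[OF intervalD(1)[OF a(1)], of \<beta> u] a(2) gt by simp
  qed
qed

lemma level_near:
  assumes "reach x u" "nr k u v"
  shows "d x u \<le> d x v + K * k"
proof -
  have *: "(u, v) \<in> E ^^ m \<Longrightarrow> d x u \<le> d x v + K * m" for m v
  proof (induction m arbitrary: v)
    case (Suc m)
    then obtain y where y: "(u, y) \<in> E ^^ m" "(y, v) \<in> E" by auto
    have "reach x y" using assms(1) relpow_imp_rtrancl[OF y(1)] by (rule rtrancl_trans)
    from level_step[OF this y(2)] Suc.IH[OF y(1)] show ?case by simp
  qed simp
  obtain m where "m \<le> k" "(u, v) \<in> E ^^ m" using assms(2) by (auto simp: near_def)
  then show ?thesis using *[of v m] mult_le_mono2[of m k K] by linarith
qed

lemma colevel_near: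
  assumes "nr k u v" "reach v x"
  shows "d v x \<le> d u x + K * k"
  using thin_digraph.level_near[OF reversed, of x v k u] assms
  by (simp add: near_converse rtrancl_converse gdist_converse)

text \<open>On strongly connected pieces the distance is symmetric up to the factor \<open>K\<close>: take levels from \<open>v\<close>
itself.\<close>
lemma quasi_symmetric:
  assumes "reach u v" "reach v u"
  shows "d v u \<le> K * d u v"
  using level_near[OF assms(2), of "d u v" v] assms(1) by (simp add: near_iff)

lemma quasi_symmetric_near: "nr k u v \<Longrightarrow> reach v u \<Longrightarrow> nr (K * k) v u"
  using quasi_symmetric[of u v] mult_le_mono2[of "d u v" k K] unfolding near_iff by linarith

text \<open>(B2) with a linear bound, from levels with respect to \<open>y\<close>.\<close>
lemma in_ball_linear: "nr r y x \<Longrightarrow> nr s z x \<Longrightarrow> reach y z \<Longrightarrow> d y z \<le> r + K * s"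
  using level_near[of y z s x] by (simp add: near_iff)

lemma out_ball_linear: "nr r x y \<Longrightarrow> nr s x z \<Longrightarrow> reach y z \<Longrightarrow> d y z \<le> s + K * r"
  using colevel_near[of r x y z] by (simp add: near_iff)

text \<open>The cost of replacing a short path from a point to a geodesic by one in the other direction.\<close>
definition turn :: "nat \<Rightarrow> nat" where "turn k = 2 * \<delta> + k + K * k + 1"

text \<open>A point \<open>a\<close> that can be reached from \<open>x\<close> and lies close in front of a geodesic from \<open>x\<close> also lies
close behind it: move a little way back from \<open>a\<close> towards \<open>x\<close>, where the triangle with
corners \<open>x\<close>, \<open>a\<close>, \<open>e\<close> is thin against its side from \<open>x\<close> to \<open>e\<close>.\<close>
lemma near_back:
  assumes "e \<in> I x w" "reach x a" "nr k a e"
  shows "\<exists>f\<in>I x w. nr (turn k) f a"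
proof -
  define m where "m = min (d x a) (\<delta> + k + K * k + 1)"
  obtain b where b: "b \<in> I x a" "d x b = d x a - m" "d b a = m"
    using interval_point[OF assms(2), of "d x a - m"] by (auto simp: m_def)
  \<comment> \<open>The point \<open>b\<close> is too far before \<open>a\<close> to be near the short side from \<open>a\<close> to \<open>e\<close>, unless it is \<open>x\<close>.\<close>
  from thin_first_interval[OF b(1) near_imp_reach[OF assms(3)]] show ?thesis
  proof (elim disjE bexE)
    fix c assume c: "c \<in> I x e" "nr \<delta> c b"
    have "nr (\<delta> + k + K * k + 1) b a" 
      using intervalD(2)[OF b(1)] b(3) by (simp add: near_iff m_def)
    from near_trans[OF c(2) this] have "nr (turn k) c a"
      by (rule near_mono) (simp add: turn_def)
    then show ?thesis using interval_mono_right[OF assms(1) c(1)] by blast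
  next
    fix c assume c: "c \<in> I a e" "nr \<delta> b c"
    have "nr k c e" using near_interval_right[OF c(1)] assms(3) by (auto simp: near_iff)
    with c(2) have "nr (\<delta> + k) b e" by (rule near_trans)
    from in_ball_linear[OF this assms(3) intervalD(2)[OF b(1)]] b(3)
    have "m \<le> \<delta> + k + K * k" by simp
    then have "m = d x a" by (simp add: m_def)
    then have "nr (turn k) x a" using assms(2) \<open>m \<le> \<delta> + k + K * k\<close> by (simp add: near_iff turn_def)
    then show ?thesis using interval_ends(1)[OF intervalD(3)[OF assms(1)]] by blast
  qed
qed

lemma near_forward:
  assumes "e \<in> I x w" "reach a w" "nr k e a"
  shows "\<exists>f\<in>I x w. nr (turn k) a f"
  using thin_digraph.near_back[OF reversed, of e w x a k] assms
  by (simp add: near_converse rtrancl_converse interval_converse)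

section \<open>Geodesics near walks\<close>

text \<open>Two geodesics that end at the same vertex \<open>y\<close> and whose starts are joined by a short path fellow
travel; the point \<open>q\<close> is taken \<open>\<delta>\<close> further away from \<open>y\<close> than \<open>c\<close>, so that the path provided by
thinness arrives before \<open>c\<close>.\<close>
lemma near_tail:
  assumes "nr \<delta> x r" "reach r y" "c \<in> I x y"
  shows "nr (4 * \<delta>) x c \<or> (\<exists>q\<in>I r y. nr (2 * \<delta> + K * \<delta>) q c)"
proof -
  define l where "l = d c y"
  have dist: "d x c + l = d x y" and xc: "reach x c" using intervalD[OF assms(3)] by (auto simp: l_def)
  have xy: "d x y \<le> \<delta> + d r y" using gdist_near_left[OF assms(1,2)] .
  show ?thesis
  proof (cases "d r y < l + \<delta>")
    case True
    then have "d x c \<le> 4 * \<delta>" using dist xy by simp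
    then show ?thesis using xc by (simp add: near_iff)
  next
    case False
    then obtain q where q: "q \<in> I r y" "d q y = l + \<delta>"
      using interval_point[OF assms(2), of "d r y - (l + \<delta>)"] by auto
    obtain A where A: "geo E x r A" using geo_exists[OF near_imp_reach[OF assms(1)]] by blast
    obtain B where B: "geo E r y B" "q \<in> B" using geo_through[OF q(1)] by blast
    obtain C where C: "geo E x y C" "c \<in> C" using geo_through[OF assms(3)] by blast
    from thin_second[OF A B(1) C(1) B(2)] show ?thesis
    proof (elim disjE bexE)
      fix a assume a: "a \<in> A" "nr \<delta> a q"
      have "a \<in> I x r" using geo_subset_interval[OF A] a(1) by blast
      from near_interval_left[OF this] have "nr \<delta> x a"
        using assms(1) by (auto simp: near_iff)
      from near_trans[OF this a(2)] have "d x y \<le> \<delta> + \<delta> + d q y"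
        using gdist_near_left intervalD(2)[OF q(1)] by metis
      then have "d x c \<le> 4 * \<delta>" using dist q(2) by simp
      then show ?thesis using xc by (simp add: near_iff)
    next
      fix e assume e: "e \<in> C" "nr \<delta> q e"
      have eI: "e \<in> I x y" using geo_subset_interval[OF C(1)] e(1) by blast
      have "d q y \<le> \<delta> + d e y" using gdist_near_left[OF e(2) intervalD(2)[OF eI]] .
      then have "d x e \<le> d x c" using q(2) dist intervalD(4)[OF eI] by simp
      note order = geo_order[OF C(1) e(1) C(2) this]
      have "d e y \<le> d q y + K * \<delta>" using colevel_near[OF e(2) intervalD(2)[OF eI]] .
      then have "d e c \<le> \<delta> + K * \<delta>" using order(2) q(2) dist intervalD(4)[OF eI] by simp
      then have "nr (\<delta> + K * \<delta>) e c" using order(1) by (simp add: near_iff)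
      from near_trans[OF e(2) this] have "nr (2 * \<delta> + K * \<delta>) q c" by (rule near_mono) simp
      then show ?thesis using q(1) by blast
    qed
  qed
qed

text \<open>The constant for one subdivision step in \<open>detour_to\<close>.\<close>
definition \<kappa> :: nat where "\<kappa> = 5 * \<delta> + 1 + K * \<delta>"

text \<open>Thinness relates a point \<open>c\<close> of the long side to the other sides by a path in one of the two
directions; here the direction is always towards \<open>c\<close>. Along the long side consider the last
point \<open>g i\<close> up to \<open>c\<close> that is near the first short side. The next point is near the second
short side, and from there on \<open>near_tail\<close> applies.\<close>
lemma detour_to:
  assumes "c \<in> I x y" "reach x m" "reach m y"
  shows "\<exists>q\<in>I x m \<union> I m y. nr \<kappa> q c"
proof -
  obtain C where C: "geo E x y C" "c \<in> C" using geo_through[OF assms(1)] by blast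
  obtain g n where g: "n = d x y" "g 0 = x" "g n = y" "C = g ` {..n}"
    "\<And>i j. i \<le> j \<Longrightarrow> j \<le> n \<Longrightarrow> reach (g i) (g j)"
    "\<And>i j. i \<le> j \<Longrightarrow> j \<le> n \<Longrightarrow> d (g i) (g j) = j - i"
    by (rule geo_param[OF C(1)]) (rule that)
  obtain k where k: "c = g k" "k \<le> n" using C(2) g(4) by auto
  define S where "S = {i. i \<le> k \<and> (\<exists>q\<in>I x m. nr \<delta> q (g i))}"
  have "finite S" by (simp add: S_def)
  have "0 \<in> S" using interval_ends(1)[OF assms(2)] g(2) by (auto simp: S_def intro!: bexI[of _ x])
  define i where "i = Max S"
  have "i \<in> S" using \<open>finite S\<close> \<open>0 \<in> S\<close> by (metis i_def Max_in empty_iff)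
  then obtain q where q: "q \<in> I x m" "nr \<delta> q (g i)" and "i \<le> k" by (auto simp: S_def)
  show ?thesis
  proof (cases "i = k")
    case True
    then have "nr \<kappa> q c" using near_mono[OF q(2), of \<kappa>] k(1) by (simp add: \<kappa>_def)
    then show ?thesis using q(1) by blast
  next
    case False
    then have "Suc i \<le> k" using \<open>i \<le> k\<close> by simp
    have "Suc i \<notin> S" using Max_ge[OF \<open>finite S\<close>, of "Suc i"] by (auto simp: i_def)
    moreover have "g (Suc i) \<in> I x y"
      using geo_subset_interval[OF C(1)] g(4) \<open>Suc i \<le> k\<close> k(2) by auto
    ultimately obtain r where r: "r \<in> I m y" "nr \<delta> (g (Suc i)) r"
      using thin_long_interval[of "g (Suc i)" x y m] assms(2,3) \<open>Suc i \<le> k\<close>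
      by (auto simp: S_def)
    have "c \<in> I (g (Suc i)) y"
      using g(5,6)[of "Suc i" k] g(5,6)[of k n] g(6)[of "Suc i" n] k g(3) \<open>Suc i \<le> k\<close>
      by (auto simp: interval_def)
    from near_tail[OF r(2) intervalD(2)[OF r(1)] this] show ?thesis
    proof (elim disjE bexE)
      assume "nr (4 * \<delta>) (g (Suc i)) c"
      moreover have "nr (\<delta> + 1) q (g (Suc i))"
        using near_trans[OF q(2), of 1 "g (Suc i)"] g(5,6)[of i "Suc i"] \<open>Suc i \<le> k\<close> k(2)
        by (simp add: near_iff)
      ultimately have "nr (\<delta> + 1 + 4 * \<delta>) q c" by (rule near_trans[rotated])
      then have "nr \<kappa> q c" by (rule near_mono) (simp add: \<kappa>_def)
      then show ?thesis using q(1) by blast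
    next
      fix s assume "s \<in> I r y" "nr (2 * \<delta> + K * \<delta>) s c"
      then have "s \<in> I m y" "nr \<kappa> s c"
        using interval_mono_left[OF r(1)] near_mono[of E "2 * \<delta> + K * \<delta>" s c \<kappa>]
        by (auto simp: \<kappa>_def)
      then show ?thesis by blast
    qed
  qed
qed

lemma detour_from:
  assumes "c \<in> I x y" "reach x m" "reach m y"
  shows "\<exists>q\<in>I x m \<union> I m y. nr \<kappa> c q"
  using thin_digraph.detour_to[OF reversed, of c y x m] assms
  by (auto simp: near_converse rtrancl_converse interval_converse)

text \<open>Halving the walk \<open>k\<close> times costs \<open>\<kappa>\<close> each time. As \<open>detour_to\<close> always yields paths in the same
direction, they can be concatenated.\<close>
lemma geodesic_near_short_walk:
  assumes "\<And>l. i \<le> l \<Longrightarrow> l < j \<Longrightarrow> (w l, w (Suc l)) \<in> E" "i \<le> j" "j - i \<le> 2 ^ k"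
    and "c \<in> I (w i) (w j)"
  shows "\<exists>l. i \<le> l \<and> l \<le> j \<and> nr (\<kappa> * k + 1) (w l) c"
  using assms
proof (induction k arbitrary: i j c)
  case 0
  have "nr (j - i) (w i) (w j)" using 0(1,2) by (rule near_walk)
  then have "d (w i) (w j) \<le> 1" using 0(3) by (simp add: near_iff)
  then have "nr 1 (w i) c" using near_interval_left[OF 0(4)] by (rule near_mono[rotated])
  then show ?case using 0(2) by (intro exI[of _ i]) simp
next
  case (Suc k)
  define m where "m = (i + j) div 2"
  have m: "i \<le> m" "m \<le> j" "m - i \<le> 2 ^ k" "j - m \<le> 2 ^ k"
    using Suc.prems(2,3) unfolding m_def by auto
  have "reach (w i) (w m)"
    using near_imp_reach[OF near_walk[of i m w E]] Suc.prems(1) m by auto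
  moreover have "reach (w m) (w j)"
    using near_imp_reach[OF near_walk[of m j w E]] Suc.prems(1) m by auto
  ultimately obtain q where q: "q \<in> I (w i) (w m) \<union> I (w m) (w j)" "nr \<kappa> q c"
    using detour_to[OF Suc.prems(4)] by blast
  have left: "(w l, w (Suc l)) \<in> E" if "i \<le> l" "l < m" for l
    using Suc.prems(1)[of l] that m(2) by simp
  have right: "(w l, w (Suc l)) \<in> E" if "m \<le> l" "l < j" for l
    using Suc.prems(1)[of l] that m(1) by simp
  have "\<exists>l. i \<le> l \<and> l \<le> j \<and> nr (\<kappa> * k + 1) (w l) q"
    using q(1)
  proof
    assume "q \<in> I (w i) (w m)"
    from Suc.IH[OF left m(1,3) this] show ?thesis using m(2) le_trans by blast
  next
    assume "q \<in> I (w m) (w j)"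
    from Suc.IH[OF right m(2,4) this] show ?thesis using m(1) le_trans by blast
  qed
  then obtain l where "i \<le> l" "l \<le> j" "nr (\<kappa> * k + 1) (w l) q" by blast
  then show ?case using near_trans[OF _ q(2), of "\<kappa> * k + 1" "w l"]
    by (intro exI[of _ l]) (simp add: algebra_simps)
qed

text \<open>The constant of \<open>middle_of_quadrilateral\<close>.\<close>
definition \<rho> :: nat where "\<rho> = turn (2 * \<delta> + turn \<delta>)"

text \<open>A point far from the short sides of a thin quadrilateral is close to the opposite long side. If
a short side is trivial, then its vertex belongs to the opposite side, and \<open>a\<close> may be
close to it.\<close>
lemma middle_of_quadrilateral:
  assumes "nr D u p" "nr D q v" "a \<in> I p q"
    and "u = p \<or> \<delta> + K * D < d p a" "q = v \<or> 2 * \<delta> + K * D < d a q"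
  shows "\<exists>h\<in>I u v. nr \<rho> h a"
proof -
  have up: "reach u p" and qv: "reach q v"
    using near_imp_reach[OF assms(1)] near_imp_reach[OF assms(2)] .
  have pq: "reach p a" "reach a q" using intervalD[OF assms(3)] by auto
  have ua: "reach u a" using up pq(1) by (rule rtrancl_trans)
  have av: "reach a v" using pq(2) qv by (rule rtrancl_trans)
  have uq: "reach u q" using ua pq(2) by (rule rtrancl_trans)
  have uv: "reach u v" using ua av by (rule rtrancl_trans)
  have \<rho>: "nr \<rho> h a" if "nr \<delta> h a" for h
    using that by (rule near_mono) (simp add: \<rho>_def turn_def)
  have forward: ?thesis if h: "h \<in> I u v" "nr (2 * \<delta> + turn \<delta>) a h" for h
    using near_back[OF h(1) ua h(2)] by (simp add: \<rho>_def)
  from thin_second_interval[OF assms(3) up] show ?thesis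
  proof (elim disjE bexE)
    fix e assume e: "e \<in> I u p" "nr \<delta> e a"
    \<comment> \<open>Otherwise (B1) at \<open>e\<close> bounds the distance from \<open>p\<close> to \<open>a\<close>.\<close>
    have "u = p"
    proof (rule ccontr)
      assume "u \<noteq> p"
      have "nr D e p" using near_interval_right[OF e(1)] assms(1) by (auto simp: near_iff)
      from out_ball_linear[OF this e(2) pq(1)] \<open>u \<noteq> p\<close> assms(4) show False by simp
    qed
    then have "nr \<rho> u a" using e \<rho> by simp
    then show ?thesis using interval_ends(1)[OF uv] by blast
  next
    fix e assume e: "e \<in> I u q" "nr \<delta> a e"
    from thin_first_interval[OF e(1) qv] show ?thesis
    proof (elim disjE bexE)
      fix h assume h: "h \<in> I u v" "nr \<delta> h e"
      have "reach e v" using intervalD(2)[OF e(1)] qv by (rule rtrancl_trans)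
      from near_forward[OF h(1) this h(2)] obtain f where f: "f \<in> I u v" "nr (turn \<delta>) e f"
        by blast
      have "nr (2 * \<delta> + turn \<delta>) a f"
        using near_trans[OF e(2) f(2)] by (rule near_mono) simp
      with f(1) show ?thesis by (rule forward)
    next
      fix h assume h: "h \<in> I q v" "nr \<delta> e h"
      have ah: "nr (2 * \<delta>) a h" using near_trans[OF e(2) h(2)] by (simp add: mult_2)
      have "q = v"
      proof (rule ccontr)
        assume "q \<noteq> v"
        have "nr D q h" using near_interval_left[OF h(1)] assms(2) by (auto simp: near_iff)
        from level_near[OF pq(2) this] ah \<open>q \<noteq> v\<close> assms(5) show False by (simp add: near_iff)
      qed
      then have "nr (2 * \<delta> + turn \<delta>) a v" using h ah near_mono[OF ah, of "2 * \<delta> + turn \<delta>"] by simp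
      with interval_ends(2)[OF uv] show ?thesis by (rule forward)
    qed
  qed
qed

section \<open>Geodesics near quasi-geodesics\<close>

definition qg_walk :: "nat \<Rightarrow> nat \<Rightarrow> (nat \<Rightarrow> 'a) \<Rightarrow> nat \<Rightarrow> bool" where
  "qg_walk \<gamma> c w n \<longleftrightarrow> (\<forall>i<n. (w i, w (Suc i)) \<in> E) \<and>
     (\<forall>i j. i \<le> j \<longrightarrow> j \<le> n \<longrightarrow> j - i \<le> \<gamma> * d (w i) (w j) + c)"

text \<open>If all points of geodesics are at distance at most \<open>D\<close> from a quasi-geodesic in both directions,
then paths of length \<open>O(log D)\<close> lead from the quasi-geodesic to these points; the other direction
follows by reversal. Around \<open>a\<close> cut out a piece from \<open>p\<close> to \<open>q\<close> of length
linear in \<open>D\<close> and join it to vertices \<open>w i\<close> and \<open>w j\<close>. Then \<open>a\<close> is close to a geodesic from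
\<open>w i\<close> to \<open>w j\<close>, and the part of the quasi-geodesic between them has length linear in \<open>D\<close>, so that
\<open>geodesic_near_short_walk\<close> applies.

The quasi-geodesic may visit \<open>w j\<close> before \<open>w i\<close>. In this case the two vertices are strongly
connected, and a geodesic in one direction is close to one in the other direction.\<close>
lemma quasi_geodesic_distance_improves:
  assumes w: "qg_walk \<gamma> c w n"
    and D: "\<And>a. a \<in> I (w 0) (w n) \<Longrightarrow> (\<exists>i\<le>n. nr D (w i) a) \<and> (\<exists>i\<le>n. nr D a (w i))"
    and k: "\<gamma> * K * (2 * D + 2 * (2 * \<delta> + K * D + 1)) + c \<le> 2 ^ k"
    and a: "a \<in> I (w 0) (w n)"
  shows "\<exists>i\<le>n. nr (\<kappa> * k + 1 + K * \<delta> + \<delta> + \<rho>) (w i) a"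
proof -
  \<comment> \<open>The smallest margin that \<open>middle_of_quadrilateral\<close> accepts on both sides.\<close>
  define S where "S = 2 * \<delta> + K * D + 1"
  have edge: "(w i, w (Suc i)) \<in> E" if "i < n" for i using w that by (simp add: qg_walk_def)
  have qg: "j - i \<le> \<gamma> * d (w i) (w j) + c" if "i \<le> j" "j \<le> n" for i j
    using w that by (simp add: qg_walk_def)
  have "\<exists>p i. p \<in> I (w 0) a \<and> i \<le> n \<and> nr D (w i) p \<and> d p a \<le> S \<and> (w i = p \<or> \<delta> + K * D < d p a)"
  proof (cases "d (w 0) a \<le> S")
    case True
    then show ?thesis
      using interval_ends(1)[OF intervalD(1)[OF a]] by (intro exI[of _ "w 0"] exI[of _ 0]) simp
  next
    case False
    then obtain p where p: "p \<in> I (w 0) a" "d p a = S"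
      using interval_point[OF intervalD(1)[OF a], of "d (w 0) a - S"] by auto
    have "p \<in> I (w 0) (w n)" using interval_mono_right[OF a p(1)] .
    then obtain i where "i \<le> n" "nr D (w i) p" using D by blast
    then show ?thesis using p by (intro exI[of _ p] exI[of _ i]) (simp add: S_def)
  qed
  then obtain p i where p: "p \<in> I (w 0) a" "i \<le> n" "nr D (w i) p" "d p a \<le> S"
    "w i = p \<or> \<delta> + K * D < d p a" by blast
  have "\<exists>q j. q \<in> I a (w n) \<and> j \<le> n \<and> nr D q (w j) \<and> d a q \<le> S \<and> (q = w j \<or> 2 * \<delta> + K * D < d a q)"
  proof (cases "d a (w n) \<le> S")
    case True
    then show ?thesis
      using interval_ends(2)[OF intervalD(2)[OF a]] by (intro exI[of _ "w n"] exI[of _ n]) simp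
  next
    case False
    then obtain q where q: "q \<in> I a (w n)" "d a q = S"
      using interval_point[OF intervalD(2)[OF a], of S] by auto
    have "q \<in> I (w 0) (w n)" using interval_mono_left[OF a q(1)] .
    then obtain j where "j \<le> n" "nr D q (w j)" using D by blast
    then show ?thesis using q by (intro exI[of _ q] exI[of _ j]) (simp add: S_def)
  qed
  then obtain q j where q: "q \<in> I a (w n)" "j \<le> n" "nr D q (w j)" "d a q \<le> S"
    "q = w j \<or> 2 * \<delta> + K * D < d a q" by blast
  have "a \<in> I p q"
    using interval_shorten_right[OF interval_shorten_left[OF a p(1)] q(1)] .
  from middle_of_quadrilateral[OF p(3) q(3) this p(5) q(5)]
  obtain h where h: "h \<in> I (w i) (w j)" "nr \<rho> h a" by blast
  have "nr S p a" "nr S a q"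
    using p(4) q(4) intervalD(2)[OF p(1)] intervalD(1)[OF q(1)] by (auto simp: near_iff)
  from near_trans[OF near_trans[OF near_trans[OF p(3) this(1)] this(2)] q(3)]
  have ij: "nr (2 * D + 2 * S) (w i) (w j)" by (rule near_mono) simp
  have K1: "1 \<le> K" by (simp add: K_def)
  have k': "\<gamma> * (K * (2 * D + 2 * S)) + c \<le> 2 ^ k" using k by (simp add: S_def algebra_simps)
  show ?thesis
  proof (cases "i \<le> j")
    case True
    have "d (w i) (w j) \<le> K * (2 * D + 2 * S)"
      using ij mult_le_mono1[OF K1, of "2 * D + 2 * S"]
      unfolding near_iff mult_1 by (blast intro: order_trans)
    then have "j - i \<le> 2 ^ k"
      using qg[OF True q(2)] k' mult_le_mono2[of "d (w i) (w j)" "K * (2 * D + 2 * S)" \<gamma>] by linarith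
    then obtain l where l: "l \<le> j" "nr (\<kappa> * k + 1) (w l) h"
      using geodesic_near_short_walk[of i j w k h] edge True q(2) h(1) by auto
    have "nr (\<kappa> * k + 1 + K * \<delta> + \<delta> + \<rho>) (w l) a"
      using near_trans[OF l(2) h(2)] by (rule near_mono) simp
    then show ?thesis using l(1) q(2) by (intro exI[of _ l]) simp
  next
    case False
    then have ji: "j \<le> i" by simp
    have ji_reach: "reach (w j) (w i)"
      using near_imp_reach[OF near_walk[of j i w E]] edge ji p(2) by auto
    have ij_reach: "reach (w i) (w j)" using near_imp_reach[OF ij] .
    have "d (w j) (w i) \<le> K * (2 * D + 2 * S)"
      using quasi_symmetric_near[OF ij ji_reach] by (simp add: near_iff)
    then have len: "i - j \<le> 2 ^ k"
      using qg[OF ji p(2)] k' mult_le_mono2[of "d (w j) (w i)" "K * (2 * D + 2 * S)" \<gamma>] by linarith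
    \<comment> \<open>The degenerate triangle with corners \<open>w i\<close>, \<open>w j\<close>, \<open>w i\<close>.\<close>
    from thin_first_interval[OF h(1) ji_reach] show ?thesis
    proof (elim disjE bexE)
      fix c assume "c \<in> I (w i) (w i)" "nr \<delta> c h"
      then have "nr (\<kappa> * k + 1 + K * \<delta> + \<delta> + \<rho>) (w i) a"
        using near_mono[OF near_trans[OF _ h(2), of \<delta> "w i"],
            of "\<kappa> * k + 1 + K * \<delta> + \<delta> + \<rho>"] by simp
      then show ?thesis using p(2) by blast
    next
      fix b assume b: "b \<in> I (w j) (w i)" "nr \<delta> h b"
      have "reach b h" using intervalD(2)[OF b(1)] intervalD(1)[OF h(1)] by (rule rtrancl_trans)
      from quasi_symmetric_near[OF b(2) this] have bh: "nr (K * \<delta>) b h" .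
      obtain l where l: "l \<le> i" "nr (\<kappa> * k + 1) (w l) b"
        using geodesic_near_short_walk[of j i w k b] edge ji p(2) b(1) len by auto
      have "nr (\<kappa> * k + 1 + K * \<delta> + \<delta> + \<rho>) (w l) a"
        using near_trans[OF near_trans[OF l(2) bh] h(2)] by (rule near_mono) simp
      then show ?thesis using l(1) p(2) by (intro exI[of _ l]) simp
    qed
  qed
qed

lemma qg_walk_reverse:
  assumes "qg_walk \<gamma> c w n"
  shows "thin_digraph.qg_walk (E\<inverse>) \<gamma> c (\<lambda>i. w (n - i)) n"
proof -
  have edge: "(w (n - Suc i), w (n - i)) \<in> E" if "i < n" for i
    using assms that Suc_diff_Suc[OF that] unfolding qg_walk_def by (metis diff_less_Suc diff_le_self order_less_le_trans Suc_le_eq)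
  have "j - i \<le> \<gamma> * d (w (n - j)) (w (n - i)) + c" if "i \<le> j" "j \<le> n" for i j
  proof -
    have "(n - i) - (n - j) = j - i" using that by simp
    then show ?thesis using assms that unfolding qg_walk_def
      by (metis diff_le_mono2 diff_le_self)
  qed
  then show ?thesis
    using edge by (simp add: thin_digraph.qg_walk_def[OF reversed] gdist_converse)
qed

text \<open>The directed Morse lemma: apply the improvement step to the smallest distance \<open>D\<close> that works for
the given walk and its reversal.\<close>
theorem geodesic_near_quasi_geodesic:
  "\<exists>M. \<forall>w n. qg_walk \<gamma> c w n \<longrightarrow>
     (\<forall>a\<in>I (w 0) (w n). (\<exists>i\<le>n. nr M (w i) a) \<and> (\<exists>i\<le>n. nr M a (w i)))"
proof -
  let ?C = "1 + K * \<delta> + \<delta> + \<rho>"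
  obtain M where M: "\<And>D. (\<And>k. \<gamma> * K * (2 + 2 * K) * D + (\<gamma> * K * (4 * \<delta> + 2) + c) \<le> 2 ^ k \<Longrightarrow>
      D \<le> ?C + \<kappa> * k) \<Longrightarrow> D \<le> M"
    using bounded_by_log_of_itself by blast
  have "(\<exists>i\<le>n. nr M (w i) a) \<and> (\<exists>i\<le>n. nr M a (w i))"
    if w: "qg_walk \<gamma> c w n" and a: "a \<in> I (w 0) (w n)" for w n a
  proof -
    define close where "close D \<longleftrightarrow>
      (\<forall>a\<in>I (w 0) (w n). (\<exists>i\<le>n. nr D (w i) a) \<and> (\<exists>i\<le>n. nr D a (w i)))" for D
    have "nr n (w 0) (w n)" using near_walk[of 0 n w E] w by (simp add: qg_walk_def)
    then have "close n"
      unfolding close_def near_iff[of E n "w 0" "w n"]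
      using near_mono[OF near_interval_left] near_mono[OF near_interval_right] by (metis le0 order_refl)
    define D where "D = (LEAST D. close D)"
    have D: "close D" unfolding D_def using \<open>close n\<close> by (rule LeastI)
    have "D \<le> ?C + \<kappa> * k"
      if "\<gamma> * K * (2 + 2 * K) * D + (\<gamma> * K * (4 * \<delta> + 2) + c) \<le> 2 ^ k" for k
    proof -
      have k: "\<gamma> * K * (2 * D + 2 * (2 * \<delta> + K * D + 1)) + c \<le> 2 ^ k"
        using that by (simp add: algebra_simps)
      have "close (\<kappa> * k + 1 + K * \<delta> + \<delta> + \<rho>)"
        unfolding close_def
      proof (intro ballI conjI)
        fix a assume a: "a \<in> I (w 0) (w n)"
        show "\<exists>i\<le>n. nr (\<kappa> * k + 1 + K * \<delta> + \<delta> + \<rho>) (w i) a"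
          using w _ k a by (rule quasi_geodesic_distance_improves) (use D close_def in blast)
        have flip: "\<exists>i\<le>n. P (w (n - i))" if "\<exists>i\<le>n. P (w i)" for P
          using that by (metis diff_diff_cancel diff_le_self)
        have "(\<exists>i\<le>n. near (E\<inverse>) D (w (n - i)) b) \<and> (\<exists>i\<le>n. near (E\<inverse>) D b (w (n - i)))"
          if "b \<in> interval (E\<inverse>) (w (n - 0)) (w (n - n))" for b
          using that D flip[of "nr D b"] flip[of "\<lambda>x. nr D x b"]
          by (simp add: close_def near_converse interval_converse)
        from thin_digraph.quasi_geodesic_distance_improves[OF reversed qg_walk_reverse[OF w] this k]
        have "\<exists>i\<le>n. near (E\<inverse>) (\<kappa> * k + 1 + K * \<delta> + \<delta> + \<rho>) (w (n - i)) a"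
          using a by (simp add: interval_converse)
        then show "\<exists>i\<le>n. nr (\<kappa> * k + 1 + K * \<delta> + \<delta> + \<rho>) a (w i)"
          unfolding near_converse by (metis diff_le_self)
      qed
      then have "D \<le> \<kappa> * k + 1 + K * \<delta> + \<delta> + \<rho>" unfolding D_def by (rule Least_le)
      then show ?thesis by simp
    qed
    then have "D \<le> M" by (rule M)
    then show ?thesis using D a near_mono unfolding close_def by metis
  qed
  then show ?thesis by blast
qed

end

section \<open>Rays up to finite sets\<close>

text \<open>What infinitely many disjoint paths amount to: no finite set separates \<open>R1\<close> from \<open>R2\<close>.\<close>
definition linked :: "('a \<times> 'a) set \<Rightarrow> (nat \<Rightarrow> 'a) \<Rightarrow> (nat \<Rightarrow> 'a) \<Rightarrow> bool" where
  "linked E R1 R2 \<longleftrightarrow> (\<forall>F. finite F \<longrightarrow>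
     (\<exists>i j. R1 i \<notin> F \<and> R2 j \<notin> F \<and> (R1 i, R2 j) \<in> (E \<inter> (- F) \<times> (- F))\<^sup>*))"

text \<open>In a locally finite digraph every ball is finite, so this implies \<open>R1 \<le> R2\<close> in the sense of
quasi-geodesic rays.\<close>
definition close :: "('a \<times> 'a) set \<Rightarrow> (nat \<Rightarrow> 'a) \<Rightarrow> (nat \<Rightarrow> 'a) \<Rightarrow> bool" where
  "close E R1 R2 \<longleftrightarrow> (\<exists>M. \<forall>F. finite F \<longrightarrow>
     (\<exists>i j. R1 i \<notin> F \<and> R2 j \<notin> F \<and> near (E \<inter> (- F) \<times> (- F)) M (R1 i) (R2 j)))"

definition qg_ray :: "('a \<times> 'a) set \<Rightarrow> (nat \<Rightarrow> 'a) \<Rightarrow> bool" where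
  "qg_ray E R \<longleftrightarrow> inj R \<and> (\<forall>i. (R i, R (Suc i)) \<in> E) \<and>
     (\<exists>\<gamma> c. \<forall>i j. i \<le> j \<longrightarrow> j - i \<le> \<gamma> * gdist E (R i) (R j) + c)"

lemma converse_restrict: "(E \<inter> A \<times> A)\<inverse> = E\<inverse> \<inter> A \<times> A"
  by auto

lemma linked_converse: "linked (E\<inverse>) R1 R2 \<longleftrightarrow> linked E R2 R1"
  unfolding linked_def converse_restrict[symmetric] rtrancl_converse converse_iff by blast

lemma close_converse: "close (E\<inverse>) R1 R2 \<longleftrightarrow> close E R2 R1"
proof -
  have "(\<exists>i j. R1 i \<notin> F \<and> R2 j \<notin> F \<and> near (E\<inverse> \<inter> (- F) \<times> (- F)) M (R1 i) (R2 j)) \<longleftrightarrow>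
      (\<exists>i j. R2 i \<notin> F \<and> R1 j \<notin> F \<and> near (E \<inter> (- F) \<times> (- F)) M (R2 i) (R1 j))" for F M
    unfolding converse_restrict[symmetric] near_converse by blast
  then show ?thesis unfolding close_def by presburger
qed

text \<open>For two geodesic rays with the same start this is what \<open>R1 \<le> R2\<close> gives.\<close>
definition often_near :: "('a \<times> 'a) set \<Rightarrow> (nat \<Rightarrow> 'a) \<Rightarrow> (nat \<Rightarrow> 'a) \<Rightarrow> bool" where
  "often_near E R1 R2 \<longleftrightarrow> (\<exists>M. \<forall>N. \<exists>i\<ge>N. \<exists>j\<ge>N. near E M (R1 i) (R2 j))"

section \<open>Geodesic rays as limits\<close>

text \<open>Geodesics as functions, so that two of them from the same start can be compared at equal levels.\<close>
definition geo_walk :: "('a \<times> 'a) set \<Rightarrow> 'a \<Rightarrow> (nat \<Rightarrow> 'a) \<Rightarrow> nat \<Rightarrow> bool" where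
  "geo_walk E x g n \<longleftrightarrow> g 0 = x \<and> (\<forall>i<n. (g i, g (Suc i)) \<in> E) \<and> gdist E x (g n) = n"

definition geo_ray :: "('a \<times> 'a) set \<Rightarrow> 'a \<Rightarrow> (nat \<Rightarrow> 'a) \<Rightarrow> bool" where
  "geo_ray E x G \<longleftrightarrow> (\<forall>n. geo_walk E x G n)"

lemma geo_walk_near:
  assumes "geo_walk E x g n" "i \<le> j" "j \<le> n"
  shows "near E (j - i) (g i) (g j)"
  using assms by (intro near_walk) (auto simp: geo_walk_def)

lemma geo_walk_reach:
  assumes "geo_walk E x g n" "j \<le> n"
  shows "(x, g j) \<in> E\<^sup>*"
  using near_imp_reach[OF geo_walk_near[OF assms(1), of 0 j]] assms by (simp add: geo_walk_def)

lemma geo_walk_dist: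
  assumes "geo_walk E x g n" "j \<le> n"
  shows "gdist E x (g j) = j"
proof -
  have "gdist E x (g j) \<le> j"
    using geo_walk_near[OF assms(1), of 0 j] assms by (simp add: near_iff geo_walk_def)
  moreover have "gdist E x (g n) \<le> gdist E x (g j) + (n - j)"
    using geo_walk_reach[OF assms] geo_walk_near[OF assms order_refl] by (rule gdist_near_right)
  ultimately show ?thesis using assms by (simp add: geo_walk_def)
qed

lemma geo_walk_prefix: "geo_walk E x g n \<Longrightarrow> m \<le> n \<Longrightarrow> geo_walk E x g m"
  using geo_walk_dist[of E x g n m] by (simp add: geo_walk_def)

lemma geo_walk_cong: "geo_walk E x g n \<Longrightarrow> (\<And>i. i \<le> n \<Longrightarrow> g i = h i) \<Longrightarrow> geo_walk E x h n"
  unfolding geo_walk_def by (metis Suc_leI le0 less_imp_le order_refl)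

lemma geo_walk_geo: "geo_walk E x g n \<Longrightarrow> geo E x (g n) (g ` {..n})"
  unfolding geo_def geo_walk_def by (intro exI[of _ g]) simp

lemma geo_walk_interval:
  "geo_walk E x g n \<Longrightarrow> j \<le> n \<Longrightarrow> g j \<in> interval E x (g n)"
  using geo_subset_interval[OF geo_walk_geo[of E x g n]] by auto

lemma geo_walk_exists:
  assumes "(x, v) \<in> E\<^sup>*"
  shows "\<exists>g. geo_walk E x g (gdist E x v) \<and> g (gdist E x v) = v"
  using relpow_walk[OF gdist_relpow[OF assms]] unfolding geo_walk_def by metis

text \<open>Geodesics from \<open>x\<close> to infinitely many vertices of \<open>R\<close> agree with \<open>G\<close> on arbitrarily long initial
segments.\<close>
definition limit_of :: "('a \<times> 'a) set \<Rightarrow> 'a \<Rightarrow> (nat \<Rightarrow> 'a) \<Rightarrow> (nat \<Rightarrow> 'a) \<Rightarrow> bool" where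
  "limit_of E x R G \<longleftrightarrow> geo_ray E x G \<and>
     (\<forall>N. infinite {k. \<exists>g n. geo_walk E x g n \<and> g n = R k \<and> N \<le> n \<and> (\<forall>i\<le>N. g i = G i)})"

definition tracks :: "('a \<times> 'a) set \<Rightarrow> 'a \<Rightarrow> (nat \<Rightarrow> 'a) \<Rightarrow> (nat \<Rightarrow> 'a) \<Rightarrow> bool" where
  "tracks E x R G \<longleftrightarrow> (\<exists>M t0. \<forall>t\<ge>t0.
     (\<exists>i. (x, R i) \<in> E\<^sup>* \<and> near E M (R i) (G t)) \<and> (\<exists>j. near E M (G t) (R j)))"

lemma finite_relpow_image:
  fixes E :: "('a \<times> 'a) set"
  assumes "\<And>x. finite (E `` {x})"
  shows "finite {y. (x, y) \<in> E ^^ n}"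
proof (induction n)
  case (Suc n)
  have "{y. (x, y) \<in> E ^^ Suc n} = (\<Union>z\<in>{z. (x, z) \<in> E ^^ n}. E `` {z})" by auto
  then show ?case using Suc assms by simp
qed simp

lemma finite_ball:
  assumes "\<And>x. finite (E `` {x})"
  shows "finite {y. near E k x y}"
proof -
  have "{y. near E k x y} = (\<Union>n\<le>k. {y. (x, y) \<in> E ^^ n})" by (auto simp: near_def)
  then show ?thesis using finite_relpow_image[OF assms] by simp
qed

text \<open>Koenig's lemma: infinitely many of the walks agree up to level \<open>N\<close>, and infinitely many of these
agree up to level \<open>N + 1\<close>, since there are only finitely many vertices at this level.\<close>
lemma koenig:
  fixes S :: "nat set"
  assumes fin: "\<And>x. finite (E `` {x})"
    and walks: "\<And>k. k \<in> S \<Longrightarrow> geo_walk E x (A k) (n k)"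
    and S: "infinite S" "\<And>N. finite {k \<in> S. n k < N}"
  shows "\<exists>G. geo_ray E x G \<and> (\<forall>N. infinite {k \<in> S. N \<le> n k \<and> (\<forall>i\<le>N. A k i = G i)})"
proof -
  define P where "P N T \<longleftrightarrow> T \<subseteq> S \<and> infinite T \<and> (\<forall>k\<in>T. N \<le> n k) \<and>
    (\<forall>k\<in>T. \<forall>l\<in>T. \<forall>i\<le>N. A k i = A l i)" for N and T :: "nat set"
  have "\<exists>T. \<forall>N. P N (T N) \<and> T (Suc N) \<subseteq> T N"
  proof (rule dependent_nat_choice)
    show "\<exists>T. P 0 T"
      using S(1) walks by (intro exI[of _ S]) (auto simp: P_def geo_walk_def)
  next
    fix T N assume T: "P N T"
    define T1 where "T1 = T - {k \<in> S. n k < Suc N}"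
    have inf: "infinite T1" using T S(2) by (simp add: P_def T1_def)
    have T1: "geo_walk E x (A k) (n k)" "Suc N \<le> n k" if "k \<in> T1" for k
      using that T walks by (auto simp: T1_def P_def)
    have "near E (Suc N) x (A k (Suc N))" if "k \<in> T1" for k
      using geo_walk_near[OF T1(1)[OF that], of 0 "Suc N"] T1[OF that] by (simp add: geo_walk_def)
    then have "(\<lambda>k. A k (Suc N)) ` T1 \<subseteq> {y. near E (Suc N) x y}" by blast
    then have "finite ((\<lambda>k. A k (Suc N)) ` T1)"
      using finite_ball[OF fin] by (rule finite_subset)
    from pigeonhole_infinite[OF inf this] obtain k0 where
      k0: "k0 \<in> T1" "infinite {k \<in> T1. A k (Suc N) = A k0 (Suc N)}" by blast
    let ?T = "{k \<in> T1. A k (Suc N) = A k0 (Suc N)}"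
    have sub: "?T \<subseteq> T1" "T1 \<subseteq> T" "T \<subseteq> S" using T by (auto simp: P_def T1_def)
    have agree: "A k i = A l i" if "k \<in> T" "l \<in> T" "i \<le> N" for k l i
      using T that unfolding P_def by blast
    have "A k i = A l i" if "k \<in> ?T" "l \<in> ?T" "i \<le> Suc N" for k l i
    proof (cases "i = Suc N")
      case False
      then have "i \<le> N" using that(3) by simp
      moreover have "k \<in> T" "l \<in> T" using that(1,2) sub by blast+
      ultimately show ?thesis using agree by blast
    qed (use that in simp)
    moreover have "?T \<subseteq> S" using sub by blast
    moreover have "Suc N \<le> n k" if "k \<in> ?T" for k using T1(2) sub(1) that by blast
    ultimately have "P (Suc N) ?T" using k0(2) unfolding P_def by blast
    moreover have "?T \<subseteq> T" using sub by blast
    ultimately show "\<exists>T'. P (Suc N) T' \<and> T' \<subseteq> T" by blast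
  qed
  then obtain T where T: "\<And>N. P N (T N)" "\<And>N. T (Suc N) \<subseteq> T N" by blast
  have mono: "T j \<subseteq> T i" if "i \<le> j" for i j
    using lift_Suc_antimono_le[of T, OF T(2) that] .
  define G where "G N = A (SOME k. k \<in> T N) N" for N
  have agree: "A k i = G i" if "k \<in> T N" "i \<le> N" for k i N
  proof -
    have "k \<in> T i" using mono[OF that(2)] that(1) by blast
    moreover from this have "(SOME k. k \<in> T i) \<in> T i" by (rule someI)
    ultimately show ?thesis using T(1)[of i] unfolding G_def P_def by blast
  qed
  have "geo_walk E x G N" for N
  proof -
    have "infinite (T N)" using T(1)[of N] by (simp add: P_def)
    then obtain k where k: "k \<in> T N" by (metis finite.emptyI ex_in_conv)
    then have "geo_walk E x (A k) (n k)" "N \<le> n k" using T(1)[of N] walks by (auto simp: P_def)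
    then show ?thesis
      using geo_walk_cong[OF geo_walk_prefix, of E x "A k" "n k" N G] agree[OF k] by blast
  qed
  moreover have "infinite {k \<in> S. N \<le> n k \<and> (\<forall>i\<le>N. A k i = G i)}" for N
  proof (rule infinite_super)
    show "T N \<subseteq> {k \<in> S. N \<le> n k \<and> (\<forall>i\<le>N. A k i = G i)}"
      using T(1)[of N] agree by (auto simp: P_def)
    show "infinite (T N)" using T(1)[of N] by (simp add: P_def)
  qed
  ultimately show ?thesis unfolding geo_ray_def by blast
qed

lemma limit_exists:
  assumes fin: "\<And>x. finite (E `` {x})"
    and R: "inj R" "\<And>k. m \<le> k \<Longrightarrow> (x, R k) \<in> E\<^sup>*"
  shows "\<exists>G. limit_of E x R G"
proof -
  define n where "n k = gdist E x (R k)" for k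
  have "\<forall>k. \<exists>g. m \<le> k \<longrightarrow> geo_walk E x g (n k) \<and> g (n k) = R k"
    using geo_walk_exists[OF R(2)] unfolding n_def by blast
  then obtain A where A: "\<And>k. m \<le> k \<Longrightarrow> geo_walk E x (A k) (n k)" "\<And>k. m \<le> k \<Longrightarrow> A k (n k) = R k"
    by metis
  have "finite {k \<in> {m..}. n k < N}" for N
  proof (rule finite_subset)
    show "{k \<in> {m..}. n k < N} \<subseteq> R -` {y. near E N x y}"
      using R(2) by (auto simp: near_iff n_def)
    show "finite (R -` {y. near E N x y})"
      using finite_ball[OF fin] R(1) by (intro finite_vimageI)
  qed
  with koenig[OF fin, of "{m..}" x A n] A(1) infinite_Ici
  obtain G where G: "geo_ray E x G"
    "\<And>N. infinite {k \<in> {m..}. N \<le> n k \<and> (\<forall>i\<le>N. A k i = G i)}" by auto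
  have "infinite {k. \<exists>g n. geo_walk E x g n \<and> g n = R k \<and> N \<le> n \<and> (\<forall>i\<le>N. g i = G i)}" for N
    using _ G(2)[of N]
  proof (rule infinite_super)
    show "{k \<in> {m..}. N \<le> n k \<and> (\<forall>i\<le>N. A k i = G i)}
        \<subseteq> {k. \<exists>g n. geo_walk E x g n \<and> g n = R k \<and> N \<le> n \<and> (\<forall>i\<le>N. g i = G i)}"
    proof
      fix k assume k: "k \<in> {k \<in> {m..}. N \<le> n k \<and> (\<forall>i\<le>N. A k i = G i)}"
      then have "m \<le> k" by simp
      from k A[OF this] show
        "k \<in> {k. \<exists>g n. geo_walk E x g n \<and> g n = R k \<and> N \<le> n \<and> (\<forall>i\<le>N. g i = G i)}" by blast
    qed
  qed
  with G(1) show ?thesis unfolding limit_of_def by blast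
qed

lemma relpow_avoiding:
  fixes E :: "('a \<times> 'a) set"
  assumes "(u, v) \<in> E ^^ m" "\<And>z k. (u, z) \<in> E\<^sup>* \<Longrightarrow> k \<le> m \<Longrightarrow> (z, v) \<in> E ^^ k \<Longrightarrow> z \<notin> F"
  shows "(u, v) \<in> (E \<inter> (- F) \<times> (- F)) ^^ m"
  using assms
proof (induction m arbitrary: u)
  case (Suc m)
  obtain y where y: "(u, y) \<in> E" "(y, v) \<in> E ^^ m" using relpow_Suc_D2[OF Suc.prems(1)] by blast
  have "u \<notin> F" using Suc.prems(2)[of u "Suc m"] Suc.prems(1) by simp
  moreover have "y \<notin> F" using Suc.prems(2)[of y m] y by auto
  moreover have "(y, v) \<in> (E \<inter> (- F) \<times> (- F)) ^^ m"
  proof (rule Suc.IH[OF y(2)])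
    fix z k assume "(y, z) \<in> E\<^sup>*" "k \<le> m" "(z, v) \<in> E ^^ k"
    then show "z \<notin> F"
      using Suc.prems(2)[of z k] converse_rtrancl_into_rtrancl[OF y(1)] by simp
  qed
  ultimately show ?case using y(1) by (intro relpow_Suc_I2[of u y]) auto
qed simp

text \<open>Every vertex on a path of length \<open>M\<close> that ends at a high level is at a high level itself, so the
path avoids a given finite set.\<close>
lemma closeI:
  assumes "\<And>N. \<exists>i j. (x, R1 i) \<in> E\<^sup>* \<and> near E M (R1 i) (R2 j) \<and> N \<le> gdist E x (R2 j)"
  shows "close E R1 R2"
  unfolding close_def
proof (rule exI[of _ M], intro allI impI)
  fix F :: "'a set" assume "finite F"
  define B where "B = (\<Sum>z\<in>F. gdist E x z)"
  have B: "gdist E x z \<le> B" if "z \<in> F" for z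
    unfolding B_def using \<open>finite F\<close> that by (intro member_le_sum) auto
  obtain i j where ij: "(x, R1 i) \<in> E\<^sup>*" "near E M (R1 i) (R2 j)" "Suc (B + M) \<le> gdist E x (R2 j)"
    using assms by blast
  have far: "z \<notin> F" if "(x, z) \<in> E\<^sup>*" "near E M z (R2 j)" for z
    using gdist_near_right[OF that] ij(3) B[of z] by auto
  obtain m where m: "m \<le> M" "(R1 i, R2 j) \<in> E ^^ m" using ij(2) by (auto simp: near_def)
  have avoid: "z \<notin> F" if z: "(R1 i, z) \<in> E\<^sup>*" "k \<le> m" "(z, R2 j) \<in> E ^^ k" for z k
  proof -
    have "near E M z (R2 j)" using z m(1) by (auto simp: near_def intro!: exI[of _ k])
    then show ?thesis using far rtrancl_trans[OF ij(1) z(1)] by blast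
  qed
  have "(R1 i, R2 j) \<in> (E \<inter> (- F) \<times> (- F)) ^^ m"
    using relpow_avoiding[OF m(2), of F] avoid by blast
  then have "near (E \<inter> (- F) \<times> (- F)) M (R1 i) (R2 j)" using m(1) by (auto simp: near_def)
  moreover have "R1 i \<notin> F" using far ij(1,2) by blast
  moreover have "R2 j \<notin> F" using far[of "R2 j"] rtrancl_trans[OF ij(1) near_imp_reach[OF ij(2)]] by simp
  ultimately show "\<exists>i j. R1 i \<notin> F \<and> R2 j \<notin> F \<and> near (E \<inter> (- F) \<times> (- F)) M (R1 i) (R2 j)"
    by blast
qed

section \<open>Fellow travelling\<close>

context thin_digraph
begin

text \<open>The fellow travelling constant. It does not depend on how far the ends are apart; that distance
only determines how long before the ends the walks have to be compared.\<close>
definition \<sigma> :: nat where "\<sigma> = 2 * \<delta> + K * \<delta>"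

text \<open>Points at equal levels need not be joined by a path in either direction. Instead, each walk is
reached from slightly earlier points of the other one; at the start, truncated subtraction yields
the common first vertex.\<close>
definition fellow :: "(nat \<Rightarrow> 'a) \<Rightarrow> (nat \<Rightarrow> 'a) \<Rightarrow> nat \<Rightarrow> bool" where
  "fellow g h N \<longleftrightarrow> (\<forall>t\<le>N. nr \<sigma> (g (t - \<delta>)) (h t) \<and> nr \<sigma> (h (t - \<delta>)) (g t))"

lemma fellow_sym: "fellow g h N \<Longrightarrow> fellow h g N"
  by (simp add: fellow_def)

lemma fellow_point:
  assumes "geo_walk E x g n" "geo_walk E x h m" "s \<le> n" "t \<le> m" "nr \<delta> (g s) (h t)"
  shows "nr \<sigma> (g (t - \<delta>)) (h t)"
proof -
  have s: "d x (g s) = s" "reach x (g s)" and t: "d x (h t) = t"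
    using geo_walk_dist geo_walk_reach assms(1-4) by metis+
  have st: "s \<le> t + K * \<delta>" using level_near[OF s(2) assms(5)] s t by simp
  have ts: "t - \<delta> \<le> s" using gdist_near_right[OF s(2) assms(5)] s t by simp
  have "nr (s - (t - \<delta>)) (g (t - \<delta>)) (g s)" using geo_walk_near[OF assms(1) ts assms(3)] .
  from near_trans[OF this assms(5)] show ?thesis
    by (rule near_mono) (use st in \<open>simp add: \<sigma>_def\<close>)
qed

text \<open>In the triangle formed by the two geodesics and a short geodesic between their ends, points well
before the ends cannot be near the short side, so they are near the other geodesic.\<close>
lemma fellow_if_ends_near:
  assumes g: "geo_walk E x g n" and h: "geo_walk E x h m" and k: "nr k (g n) (h m)"
    and N: "N + (\<delta> + k + K * k + 1) \<le> n" "N + (\<delta> + k + K * k + 1) \<le> m"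
  shows "fellow g h N"
  unfolding fellow_def
proof (intro allI impI conjI)
  fix t assume "t \<le> N"
  then have tn: "t \<le> n" "t \<le> m" using N by simp_all
  obtain B where B: "geo E (g n) (h m) B" using geo_exists near_imp_reach[OF k] by metis
  have to_end: "nr k b (h m)" if "b \<in> B" for b
    using near_interval_right[of b E "g n" "h m"] geo_subset_interval[OF B] that k
    by (auto simp: near_iff)
  have "h t \<in> h ` {..m}" using tn by simp
  from thin_long[OF geo_walk_geo[OF g] B geo_walk_geo[OF h] this] show "nr \<sigma> (g (t - \<delta>)) (h t)"
  proof (elim disjE bexE)
    fix a assume "a \<in> g ` {..n}" "nr \<delta> a (h t)"
    then show ?thesis using fellow_point[OF g h _ tn(2)] by auto
  next
    fix b assume "b \<in> B" "nr \<delta> (h t) b"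
    from near_trans[OF this(2) to_end[OF this(1)]] have "m \<le> t + (\<delta> + k)"
      using gdist_near_right[OF geo_walk_reach[OF h tn(2)], of "\<delta> + k" "h m"]
        geo_walk_dist[OF h tn(2)] geo_walk_dist[OF h order_refl] by simp
    then show ?thesis using N \<open>t \<le> N\<close> by simp
  qed
  have "g t \<in> g ` {..n}" using tn by simp
  from thin_first[OF geo_walk_geo[OF g] B geo_walk_geo[OF h] this] show "nr \<sigma> (h (t - \<delta>)) (g t)"
  proof (elim disjE bexE)
    fix a assume "a \<in> h ` {..m}" "nr \<delta> a (g t)"
    then show ?thesis using fellow_point[OF h g _ tn(1)] by auto
  next
    fix b assume "b \<in> B" "nr \<delta> (g t) b"
    from near_trans[OF this(2) to_end[OF this(1)]] have "nr (\<delta> + k) (g t) (h m)" .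
    from in_ball_linear[OF this k near_imp_reach[OF geo_walk_near[OF g tn(1) order_refl]]]
    have "d (g t) (g n) \<le> \<delta> + k + K * k" .
    moreover have "n \<le> t + d (g t) (g n)"
      using gdist_triangle[OF geo_walk_reach[OF g tn(1)], of "g n"]
        near_imp_reach[OF geo_walk_near[OF g tn(1) order_refl]]
        geo_walk_dist[OF g tn(1)] geo_walk_dist[OF g order_refl] by simp
    ultimately show ?thesis using N \<open>t \<le> N\<close> by simp
  qed
qed

lemma geo_rays_fellow:
  assumes "geo_ray E x G" "geo_ray E x H" "\<And>N. \<exists>i\<ge>N. \<exists>j\<ge>N. nr k (G i) (H j)"
  shows "fellow G H N"
proof -
  obtain i j where "N + (\<delta> + k + K * k + 1) \<le> i" "N + (\<delta> + k + K * k + 1) \<le> j" "nr k (G i) (H j)"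
    using assms(3) by blast
  then show ?thesis
    using fellow_if_ends_near[of x G i H j k N] assms(1,2) by (simp add: geo_ray_def)
qed

lemma fellow_trans:
  assumes "geo_ray E x G" "geo_ray E x J" "\<And>N. fellow G H N" "\<And>N. fellow H J N"
  shows "fellow G J N"
  using assms(1,2)
proof (rule geo_rays_fellow)
  fix N
  have "nr \<sigma> (G (N + \<delta> - \<delta>)) (H (N + \<delta>))" "nr \<sigma> (H (N + 2 * \<delta> - \<delta>)) (J (N + 2 * \<delta>))"
    using assms(3)[of "N + \<delta>"] assms(4)[of "N + 2 * \<delta>"] unfolding fellow_def by blast+
  then have "nr \<sigma> (G N) (H (N + \<delta>))" "nr \<sigma> (H (N + \<delta>)) (J (N + 2 * \<delta>))"
    by (simp_all add: mult_2)
  from near_trans[OF this] show "\<exists>i\<ge>N. \<exists>j\<ge>N. nr (\<sigma> + \<sigma>) (G i) (J j)"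
    by (intro exI[of _ N] conjI exI[of _ "N + 2 * \<delta>"]) auto
qed

lemma often_near_fellow:
  assumes "geo_ray E x G" "geo_ray E x H" "often_near E G H"
  shows "fellow G H N"
  using assms(3) geo_rays_fellow[OF assms(1,2)] unfolding often_near_def by blast

section \<open>Quasi-geodesic rays near their limits\<close>

text \<open>A point \<open>G t\<close> lies on a geodesic from \<open>x\<close> to a vertex \<open>R k\<close>. By \<open>detour_to\<close> and \<open>detour_from\<close> it
is near a geodesic to \<open>R m\<close>, which is impossible at high levels, or near one from \<open>R m\<close> to \<open>R k\<close>,
which is near \<open>R\<close>.\<close>
lemma qg_ray_tracks_limit:
  assumes R: "qg_ray E R" and x: "reach x (R m)" and lim: "limit_of E x R G"
  shows "tracks E x R G"
proof -
  obtain \<gamma> c where edge: "\<And>i. (R i, R (Suc i)) \<in> E"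
    and qg: "\<And>i j. i \<le> j \<Longrightarrow> j - i \<le> \<gamma> * d (R i) (R j) + c"
    using R unfolding qg_ray_def by blast
  obtain M where M: "\<And>w n a. qg_walk \<gamma> c w n \<Longrightarrow> a \<in> I (w 0) (w n) \<Longrightarrow>
      (\<exists>i\<le>n. nr M (w i) a) \<and> (\<exists>i\<le>n. nr M a (w i))"
    using geodesic_near_quasi_geodesic by metis
  have "(\<exists>i. reach x (R i) \<and> nr (M + \<kappa>) (R i) (G t)) \<and> (\<exists>j. nr (M + \<kappa>) (G t) (R j))"
    if t: "Suc (d x (R m) + K * \<kappa> + \<kappa>) \<le> t" for t
  proof -
    have "infinite {k. \<exists>g n. geo_walk E x g n \<and> g n = R k \<and> t \<le> n \<and> (\<forall>i\<le>t. g i = G i)}"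
      using lim by (simp add: limit_of_def)
    then obtain k g n where k: "m \<le> k" "geo_walk E x g n" "g n = R k" "t \<le> n" "\<forall>i\<le>t. g i = G i"
      unfolding infinite_nat_iff_unbounded_le by blast
    have Gt: "G t \<in> I x (R k)" "d x (G t) = t" "reach x (G t)"
      using geo_walk_interval[OF k(2,4)] geo_walk_dist[OF k(2,4)] geo_walk_reach[OF k(2,4)] k(3,5)
      by auto
    have up: "reach (R m) (R j)" if "m \<le> j" for j
      using near_imp_reach[OF near_walk[of m j R E]] edge that by auto
    have walk: "qg_walk \<gamma> c (\<lambda>i. R (m + i)) (k - m)"
      using edge qg[of "m + i" "m + j" for i j] by (simp add: qg_walk_def)
    have morse: "\<exists>i. reach x (R i) \<and> nr M (R i) a" "\<exists>j. nr M a (R j)" if "a \<in> I (R m) (R k)" for a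
      using M[OF walk, of a] that k(1) rtrancl_trans[OF x up] le_add1 by (auto, metis)
    obtain q where q: "q \<in> I x (R m) \<union> I (R m) (R k)" "nr \<kappa> q (G t)"
      using detour_to[OF Gt(1) x up[OF k(1)]] by blast
    have "q \<notin> I x (R m)"
    proof
      assume "q \<in> I x (R m)"
      then have "d x (G t) \<le> d x (R m) + \<kappa>"
        using gdist_near_right[OF _ q(2), of x] intervalD[of q E x "R m"] by simp
      then show False using t Gt(2) by simp
    qed
    then obtain i where i: "reach x (R i)" "nr M (R i) q" using q(1) morse by blast
    obtain p where p: "p \<in> I x (R m) \<union> I (R m) (R k)" "nr \<kappa> (G t) p"
      using detour_from[OF Gt(1) x up[OF k(1)]] by blast
    have "p \<notin> I x (R m)"
    proof
      assume "p \<in> I x (R m)"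
      then have "d x (G t) \<le> d x (R m) + K * \<kappa>"
        using level_near[OF Gt(3) p(2)] intervalD[of p E x "R m"] by simp
      then show False using t Gt(2) by simp
    qed
    then obtain j where j: "nr M p (R j)" using p(1) morse by blast
    show ?thesis
      using i(1) near_trans[OF i(2) q(2)] near_trans[OF p(2) j] by (auto simp: add.commute)
  qed
  then show ?thesis unfolding tracks_def by blast
qed

text \<open>Here the geodesic to \<open>R k\<close> and the anti-ray run in opposite directions, and thinness only provides
paths from \<open>G\<close> to \<open>R\<close>. The paths back come from quasi-symmetry, which is why \<open>x\<close> has to be
strongly connected to \<open>R\<close>.\<close>
lemma qg_antiray_tracks_limit:
  assumes R: "qg_ray (E\<inverse>) R" and x: "\<And>k. reach x (R k)" "reach (R m) x" and lim: "limit_of E x R G"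
  shows "tracks E x R G"
proof -
  obtain \<gamma> c where edge: "\<And>i. (R (Suc i), R i) \<in> E"
    and qg: "\<And>i j. i \<le> j \<Longrightarrow> j - i \<le> \<gamma> * d (R j) (R i) + c"
    using R unfolding qg_ray_def gdist_converse converse_iff by blast
  obtain M where M: "\<And>w n a. qg_walk \<gamma> c w n \<Longrightarrow> a \<in> I (w 0) (w n) \<Longrightarrow>
      (\<exists>i\<le>n. nr M (w i) a) \<and> (\<exists>i\<le>n. nr M a (w i))"
    using geodesic_near_quasi_geodesic by metis
  have "(\<exists>i. reach x (R i) \<and> nr (K * (\<delta> + M) + (\<delta> + M)) (R i) (G t)) \<and>
      (\<exists>j. nr (K * (\<delta> + M) + (\<delta> + M)) (G t) (R j))"
    if t: "Suc (d x (R m) + \<delta>) \<le> t" for t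
  proof -
    have "infinite {k. \<exists>g n. geo_walk E x g n \<and> g n = R k \<and> t \<le> n \<and> (\<forall>i\<le>t. g i = G i)}"
      using lim by (simp add: limit_of_def)
    then obtain k g n where k: "m \<le> k" "geo_walk E x g n" "g n = R k" "t \<le> n" "\<forall>i\<le>t. g i = G i"
      unfolding infinite_nat_iff_unbounded_le by blast
    have Gt: "G t \<in> I x (R k)" "d x (G t) = t" "reach x (G t)"
      using geo_walk_interval[OF k(2,4)] geo_walk_dist[OF k(2,4)] geo_walk_reach[OF k(2,4)] k(3,5)
      by auto
    have walk: "qg_walk \<gamma> c (\<lambda>i. R (k - i)) (k - m)"
      unfolding qg_walk_def
    proof (intro conjI allI impI)
      fix i assume "i < k - m"
      then show "(R (k - i), R (k - Suc i)) \<in> E" using edge[of "k - Suc i"] by (simp add: Suc_diff_Suc)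
    next
      fix i j assume "i \<le> j" "j \<le> k - m"
      then show "j - i \<le> \<gamma> * d (R (k - i)) (R (k - j)) + c" using qg[of "k - j" "k - i"] by simp
    qed
    have down: "reach (R j) (R m)" if "m \<le> j" for j
      using that
    proof (induction j rule: dec_induct)
      case (step j)
      then show ?case using edge[of j] by (meson converse_rtrancl_into_rtrancl)
    qed simp
    from thin_first_interval[OF Gt(1) down[OF k(1)]]
    obtain b where b: "b \<in> I (R k) (R m)" "nr \<delta> (G t) b"
    proof (elim disjE bexE)
      fix c assume c: "c \<in> I x (R m)" "nr \<delta> c (G t)"
      have "d x (G t) \<le> d x (R m) + \<delta>"
        using gdist_near_right[OF intervalD(1)[OF c(1)] c(2)] intervalD(4)[OF c(1)] by simp
      then show thesis using t Gt(2) by simp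
    qed
    obtain i where i: "i \<le> k - m" "nr M b (R (k - i))"
      using M[OF walk, of b] b(1) k(1) by auto
    have G_R: "nr (\<delta> + M) (G t) (R (k - i))" using near_trans[OF b(2) i(2)] .
    have "reach (R (k - i)) (G t)"
      using rtrancl_trans[OF rtrancl_trans[OF down x(2)] Gt(3)] i(1) k(1) by simp
    from quasi_symmetric_near[OF G_R this] x(1) near_mono[OF G_R] near_mono show ?thesis
      by (meson le_add1 le_add2)
  qed
  then show ?thesis unfolding tracks_def by blast
qed

end

section \<open>Colouring far vertices by boundary points\<close>

context thin_digraph
begin

lemma fellowD: "fellow g h N \<Longrightarrow> t \<le> N \<Longrightarrow> nr \<sigma> (g (t - \<delta>)) (h t)"
  by (simp add: fellow_def)

text \<open>Fellow travelling is transitive on geodesic rays, so a smallest covering set contains no two rays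
that fellow travel.\<close>
lemma minimal_representatives:
  assumes "finite S" "\<And>H. H \<in> S \<Longrightarrow> geo_ray E x H"
    and "\<And>G. geo_ray E x G \<Longrightarrow> \<exists>H\<in>S. \<forall>N. fellow H G N"
  obtains T where "finite T" "\<And>H. H \<in> T \<Longrightarrow> geo_ray E x H"
    "\<And>G. geo_ray E x G \<Longrightarrow> \<exists>H\<in>T. \<forall>N. fellow H G N"
    "\<And>H H'. H \<in> T \<Longrightarrow> H' \<in> T \<Longrightarrow> (\<And>N. fellow H H' N) \<Longrightarrow> H = H'"
proof -
  define P where "P T \<longleftrightarrow> finite T \<and> (\<forall>H\<in>T. geo_ray E x H) \<and>
    (\<forall>G. geo_ray E x G \<longrightarrow> (\<exists>H\<in>T. \<forall>N. fellow H G N))" for T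
  have "P S" using assms unfolding P_def by blast
  then obtain T where T: "P T" and min: "\<And>T'. P T' \<Longrightarrow> card T \<le> card T'"
    using ex_has_least_nat[of P S card] by blast
  have unique: "H = H'" if H: "H \<in> T" "H' \<in> T" "\<And>N. fellow H H' N" for H H'
  proof (rule ccontr)
    assume "H \<noteq> H'"
    have "\<exists>J\<in>T - {H'}. \<forall>N. fellow J G N" if G: "geo_ray E x G" for G
    proof -
      obtain J where J: "J \<in> T" "\<And>N. fellow J G N" using T G unfolding P_def by blast
      have "fellow H G N" if "J = H'" for N
        using fellow_trans[OF _ G H(3), of N] J(2) that H(1) T by (auto simp: P_def)
      then show ?thesis using J H(1) \<open>H \<noteq> H'\<close> by (cases "J = H'") blast+
    qed
    then have "P (T - {H'})" using T by (simp add: P_def)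
    from min[OF this] show False
      using card_Diff1_less[of T H'] H(2) T by (simp add: P_def)
  qed
  show thesis
    by (rule that[of T]) (use T unique in \<open>auto simp: P_def\<close>)
qed

text \<open>Geodesic rays from \<open>x\<close> that do not fellow travel are eventually as far apart as desired, and there
are only finitely many pairs.\<close>
lemma separating_level:
  assumes "finite T" "\<And>H. H \<in> T \<Longrightarrow> geo_ray E x H"
    and "\<And>H H'. H \<in> T \<Longrightarrow> H' \<in> T \<Longrightarrow> (\<And>N. fellow H H' N) \<Longrightarrow> H = H'"
  shows "\<exists>N. \<forall>H\<in>T. \<forall>H'\<in>T. nr k (H (N - l)) (H' N) \<longrightarrow> H = H'"
proof -
  have "\<forall>H\<in>T. \<forall>H'\<in>T. eventually (\<lambda>N. nr k (H (N - l)) (H' N) \<longrightarrow> H = H') sequentially"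
  proof (intro ballI)
    fix H H' assume H: "H \<in> T" "H' \<in> T"
    show "eventually (\<lambda>N. nr k (H (N - l)) (H' N) \<longrightarrow> H = H') sequentially"
    proof (cases "H = H'")
      case False
      then obtain N0 where "\<not> fellow H H' N0" using assms(3) H by blast
      then obtain N1 where N1: "\<And>i j. i \<ge> N1 \<Longrightarrow> j \<ge> N1 \<Longrightarrow> \<not> nr k (H i) (H' j)"
        using geo_rays_fellow[of x H H' k N0] assms(2) H by blast
      show ?thesis
        unfolding eventually_sequentially
        by (intro exI[of _ "N1 + l"]) (use N1 in auto)
    qed simp
  qed
  then have "eventually (\<lambda>N. \<forall>H\<in>T. \<forall>H'\<in>T. nr k (H (N - l)) (H' N) \<longrightarrow> H = H') sequentially"
    using assms(1) by (simp add: eventually_ball_finite)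
  then show ?thesis using eventually_happens by fastforce
qed

text \<open>For a vertex \<open>v\<close> far beyond level \<open>N\<close> the colour \<open>H\<close> tells towards which boundary point the vertex
lies.\<close>
definition coloured :: "'a \<Rightarrow> nat \<Rightarrow> (nat \<Rightarrow> 'a) \<Rightarrow> 'a \<Rightarrow> bool" where
  "coloured x N H v \<longleftrightarrow> (\<exists>g n. geo_walk E x g n \<and> g n = v \<and> N \<le> n \<and> fellow H g N)"

text \<open>Geodesics to adjacent vertices fellow travel up to level \<open>N\<close>. Going from \<open>H\<close> to \<open>g\<close> to \<open>h\<close> to \<open>H'\<close>
takes three fellow travelling steps, each of which raises the level by \<open>\<delta>\<close>.\<close>
lemma colour_unique:
  assumes sep: "nr (3 * \<sigma>) (H (N - 3 * \<delta>)) (H' N) \<longrightarrow> H = H'"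
    and col: "coloured x N H u" "coloured x N H' v" and uv: "nr 1 u v \<or> nr 1 v u"
    and far: "N + (\<delta> + 1 + K * 1 + 1) \<le> d x u" "N + (\<delta> + 1 + K * 1 + 1) \<le> d x v"
  shows "H = H'"
proof -
  obtain g n where g: "geo_walk E x g n" "g n = u" "fellow H g N"
    using col(1) unfolding coloured_def by blast
  obtain h m where h: "geo_walk E x h m" "h m = v" "fellow H' h N"
    using col(2) unfolding coloured_def by blast
  have nm: "d x u = n" "d x v = m" using g(1,2) h(1,2) unfolding geo_walk_def by auto
  have "fellow g h N"
    using uv
  proof
    assume "nr 1 u v"
    then show ?thesis using fellow_if_ends_near[OF g(1) h(1), of 1 N] g(2) h(2) far nm by simp
  next
    assume "nr 1 v u"
    then have "fellow h g N"
      using fellow_if_ends_near[OF h(1) g(1), of 1 N] g(2) h(2) far nm by simp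
    then show ?thesis by (rule fellow_sym)
  qed
  then have "nr \<sigma> (g (N - \<delta> - \<delta>)) (h (N - \<delta>))"
    by (rule fellowD) simp
  moreover have "nr \<sigma> (H (N - \<delta> - \<delta> - \<delta>)) (g (N - \<delta> - \<delta>))"
    using g(3) by (rule fellowD) simp
  moreover have "nr \<sigma> (h (N - \<delta>)) (H' N)"
    using fellow_sym[OF h(3)] by (rule fellowD) simp
  ultimately have "nr (\<sigma> + \<sigma> + \<sigma>) (H (N - \<delta> - \<delta> - \<delta>)) (H' N)"
    using near_trans by metis
  moreover have "N - \<delta> - \<delta> - \<delta> = N - 3 * \<delta>" "\<sigma> + \<sigma> + \<sigma> = 3 * \<sigma>" by simp_all
  ultimately show ?thesis using sep by simp
qed

text \<open>Otherwise geodesics to a sequence of uncoloured vertices would have a limit ray, whose colour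
would be a colour of infinitely many of these vertices.\<close>
lemma far_vertices_coloured:
  assumes fin: "\<And>y. finite (E `` {y})"
    and T: "\<And>G. geo_ray E x G \<Longrightarrow> \<exists>H\<in>T. \<forall>N. fellow H G N"
  shows "\<exists>L. \<forall>v. reach x v \<longrightarrow> L \<le> d x v \<longrightarrow> (\<exists>H\<in>T. coloured x N H v)"
proof (rule ccontr)
  assume "\<not> ?thesis"
  then have "\<forall>L. \<exists>v. reach x v \<and> L \<le> d x v \<and> (\<forall>H\<in>T. \<not> coloured x N H v)" by blast
  then obtain V where V: "\<And>L. reach x (V L)" "\<And>L. L \<le> d x (V L)"
    "\<And>L H. H \<in> T \<Longrightarrow> \<not> coloured x N H (V L)" by metis
  have "\<forall>L. \<exists>g. geo_walk E x g (d x (V L)) \<and> g (d x (V L)) = V L"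
    using geo_walk_exists[OF V(1)] by blast
  then obtain A where A: "\<And>L. geo_walk E x (A L) (d x (V L))" "\<And>L. A L (d x (V L)) = V L" by metis
  have "finite {k \<in> UNIV. d x (V k) < M}" for M
    by (rule finite_subset[of _ "{..<M}"]) (use V(2) in \<open>auto intro: le_less_trans\<close>)
  with koenig[OF fin, of UNIV x A "\<lambda>L. d x (V L)"] A(1)
  obtain G where G: "geo_ray E x G" "\<And>M. infinite {k. M \<le> d x (V k) \<and> (\<forall>i\<le>M. A k i = G i)}"
    by auto
  obtain H where H: "H \<in> T" "\<And>N. fellow H G N" using T[OF G(1)] by blast
  obtain k where k: "N \<le> d x (V k)" "\<forall>i\<le>N. A k i = G i"
    using infinite_imp_nonempty[OF G(2)[of N]] by blast
  have "fellow H (A k) N"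
    using H(2)[of N] k(2) unfolding fellow_def by simp
  then have "coloured x N H (V k)"
    using A[of k] k(1) unfolding coloured_def by blast
  then show False using V(3) H(1) by blast
qed

lemma close_via_limits:
  assumes G: "geo_ray E x G1" "geo_ray E x G2" "\<And>N. fellow G1 G2 N"
    and tr: "tracks E x R1 G1" "tracks E x R2 G2"
  shows "close E R1 R2"
proof -
  obtain M1 t1 where 1: "\<And>t. t1 \<le> t \<Longrightarrow> \<exists>i. reach x (R1 i) \<and> nr M1 (R1 i) (G1 t)"
    using tr(1) unfolding tracks_def by blast
  obtain M2 t2 where 2: "\<And>t. t2 \<le> t \<Longrightarrow> \<exists>j. nr M2 (G2 t) (R2 j)"
    using tr(2) unfolding tracks_def by blast
  show ?thesis
  proof (rule closeI)
    fix N
    \<comment> \<open>The summand \<open>K * M2\<close> makes up for the level that the last part of the path can lose.\<close>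
    define t where "t = t1 + t2 + K * M2 + N"
    obtain i where i: "reach x (R1 i)" "nr M1 (R1 i) (G1 t)" using 1[of t] by (auto simp: t_def)
    obtain j where j: "nr M2 (G2 (t + \<delta>)) (R2 j)" using 2[of "t + \<delta>"] by (auto simp: t_def)
    have "nr \<sigma> (G1 (t + \<delta> - \<delta>)) (G2 (t + \<delta>))" using G(3)[of "t + \<delta>"] unfolding fellow_def by blast
    then have "nr \<sigma> (G1 t) (G2 (t + \<delta>))" by simp
    from near_trans[OF near_trans[OF i(2) this] j] have "nr (M1 + \<sigma> + M2) (R1 i) (R2 j)" .
    moreover have "N \<le> d x (R2 j)"
    proof -
      have G2: "geo_walk E x G2 (t + \<delta>)" using G(2) by (simp add: geo_ray_def)
      have "t + \<delta> \<le> d x (R2 j) + K * M2"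
        using level_near[OF geo_walk_reach[OF G2 order_refl] j] geo_walk_dist[OF G2 order_refl] by simp
      then show ?thesis by (simp add: t_def)
    qed
    ultimately show "\<exists>i j. reach x (R1 i) \<and> nr (M1 + \<sigma> + M2) (R1 i) (R2 j) \<and> N \<le> d x (R2 j)"
      using i(1) by blast
  qed
qed

text \<open>The discrete form of the connectedness argument: far out, the colour is constant along each of the
two rays, where it is the class of the limit, and along any path between them.\<close>
lemma linked_imp_same_limit:
  assumes fin: "\<And>y. finite (E `` {y})"
    and T: "finite T" "\<And>H. H \<in> T \<Longrightarrow> geo_ray E x H"
      "\<And>G. geo_ray E x G \<Longrightarrow> \<exists>H\<in>T. \<forall>N. fellow H G N"
    and R1: "inj R1" "\<And>i. (R1 i, R1 (Suc i)) \<in> E \<or> (R1 (Suc i), R1 i) \<in> E"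
      "\<And>i. m1 \<le> i \<Longrightarrow> reach x (R1 i)" "limit_of E x R1 G1"
    and R2: "inj R2" "\<And>i. (R2 i, R2 (Suc i)) \<in> E \<or> (R2 (Suc i), R2 i) \<in> E"
      "\<And>i. m2 \<le> i \<Longrightarrow> reach x (R2 i)" "limit_of E x R2 G2"
    and link: "linked E R1 R2"
  shows "fellow G1 G2 M"
proof -
  obtain T where T: "finite T" "\<And>H. H \<in> T \<Longrightarrow> geo_ray E x H"
      "\<And>G. geo_ray E x G \<Longrightarrow> \<exists>H\<in>T. \<forall>N. fellow H G N"
      "\<And>H H'. H \<in> T \<Longrightarrow> H' \<in> T \<Longrightarrow> (\<And>N. fellow H H' N) \<Longrightarrow> H = H'"
    using minimal_representatives[OF T] by metis
  obtain N where N: "\<And>H H'. H \<in> T \<Longrightarrow> H' \<in> T \<Longrightarrow> nr (3 * \<sigma>) (H (N - 3 * \<delta>)) (H' N) \<longrightarrow> H = H'"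
    using separating_level[OF T(1,2,4), of "3 * \<sigma>" "3 * \<delta>"] by metis
  obtain L0 where L0: "\<And>v. reach x v \<Longrightarrow> L0 \<le> d x v \<Longrightarrow> \<exists>H\<in>T. coloured x N H v"
    using far_vertices_coloured[OF fin T(3), where N = N] by metis
  define L where "L = L0 + (N + (\<delta> + 1 + K * 1 + 1))"
  define B where "B = {y. nr L x y}"
  have "finite B" unfolding B_def using fin by (rule finite_ball)
  have far: "L \<le> d x v" if "reach x v" "v \<notin> B" for v
    using that by (simp add: B_def near_iff)
  have coloured: "\<exists>H\<in>T. coloured x N H v" if "reach x v" "v \<notin> B" for v
    using L0[OF that(1)] far[OF that] by (simp add: L_def)
  have transfer: "coloured x N H v"
    if uv: "H \<in> T" "coloured x N H u" "reach x u" "u \<notin> B" "reach x v" "v \<notin> B" "nr 1 u v \<or> nr 1 v u" for H u v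
  proof -
    obtain H' where H': "H' \<in> T" "coloured x N H' v" using coloured[OF uv(5,6)] by blast
    have "H = H'"
      by (rule colour_unique[OF N[OF uv(1) H'(1)] uv(2) H'(2) uv(7)])
        (use far[OF uv(3,4)] far[OF uv(5,6)] in \<open>simp_all add: L_def\<close>)
    then show ?thesis using H'(2) by simp
  qed
  have tail: "\<exists>H\<in>T. (\<forall>N. fellow H G N) \<and> (\<exists>n0. \<forall>n\<ge>n0. coloured x N H (R n))"
    if R: "inj R" "\<And>i. (R i, R (Suc i)) \<in> E \<or> (R (Suc i), R i) \<in> E"
      "\<And>i. m \<le> i \<Longrightarrow> reach x (R i)" "limit_of E x R G" for R G m
  proof -
    obtain H where H: "H \<in> T" "\<And>N. fellow H G N" using T(3) R(4) unfolding limit_of_def by blast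
    have "finite (R -` B)" using \<open>finite B\<close> R(1) by (rule finite_vimageI)
    then obtain n1 where "\<forall>n\<in>R -` B. n < n1" using finite_nat_set_iff_bounded by blast
    then have n1: "R n \<notin> B" if "n1 \<le> n" for n
      using that leD vimageI2[of R n B] by blast
    have "infinite {k. \<exists>g n. geo_walk E x g n \<and> g n = R k \<and> N \<le> n \<and> (\<forall>i\<le>N. g i = G i)}"
      using R(4) by (simp add: limit_of_def)
    then obtain k g n where k: "max m n1 \<le> k" "geo_walk E x g n" "g n = R k" "N \<le> n" "\<forall>i\<le>N. g i = G i"
      unfolding infinite_nat_iff_unbounded_le by blast
    have "fellow H g N" using H(2)[of N] k(5) unfolding fellow_def by simp
    then have base: "coloured x N H (R k)" using k unfolding coloured_def by blast
    have "coloured x N H (R n)" if "k \<le> n" for n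
      using that
    proof (induction n rule: dec_induct)
      case base
      show ?case by fact
    next
      case (step n)
      have "nr 1 (R n) (R (Suc n)) \<or> nr 1 (R (Suc n)) (R n)"
        using R(2)[of n] near_edge[of "R n" "R (Suc n)" E] near_edge[of "R (Suc n)" "R n" E] by auto
      then show ?case
        using transfer[OF H(1) step(3)] R(3) n1 k(1) step(1) by simp
    qed
    then show ?thesis using H by blast
  qed
  obtain H1 n1 where H1: "H1 \<in> T" "\<And>N. fellow H1 G1 N" "\<And>n. n1 \<le> n \<Longrightarrow> coloured x N H1 (R1 n)"
    using tail[OF R1] by blast
  obtain H2 n2 where H2: "H2 \<in> T" "\<And>N. fellow H2 G2 N" "\<And>n. n2 \<le> n \<Longrightarrow> coloured x N H2 (R2 n)"
    using tail[OF R2] by blast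
  \<comment> \<open>A path that avoids \<open>F\<close> joins the coloured tails and never comes close to \<open>x\<close>.\<close>
  define F where "F = B \<union> R1 ` {..n1 + m1} \<union> R2 ` {..n2}"
  have "finite F" using \<open>finite B\<close> by (simp add: F_def)
  then obtain i j where ij: "R1 i \<notin> F" "R2 j \<notin> F" "(R1 i, R2 j) \<in> (E \<inter> (- F) \<times> (- F))\<^sup>*"
    using link unfolding linked_def by blast
  have "n1 + m1 \<le> i" "n2 \<le> j"
    using ij(1,2) by (auto simp: F_def not_le intro: ccontr)
  have "reach x y \<and> y \<notin> B \<and> coloured x N H1 y" if "(R1 i, y) \<in> (E \<inter> (- F) \<times> (- F))\<^sup>*" for y
    using that
  proof (induction rule: rtrancl_induct)
    case base
    show ?case using R1(3)[of i] H1(3)[of i] \<open>n1 + m1 \<le> i\<close> ij(1) by (simp add: F_def)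
  next
    case (step y z)
    have z: "reach x z" "z \<notin> B" using step(2,3) rtrancl_into_rtrancl[of x y E z] by (auto simp: F_def)
    moreover have "nr 1 y z" using step(2) near_edge[of y z E] by auto
    ultimately show ?case using transfer[OF H1(1), of y z] step(3) by blast
  qed
  from this[OF ij(3)] have R2j: "reach x (R2 j)" "R2 j \<notin> B" "coloured x N H1 (R2 j)" by auto
  have "H1 = H2"
    by (rule colour_unique[OF N[OF H1(1) H2(1)] R2j(3) H2(3)[OF \<open>n2 \<le> j\<close>]])
      (use far[OF R2j(1,2)] in \<open>simp_all add: L_def\<close>)
  then show ?thesis
    using fellow_trans[of x G1 G2 H1 M] R1(4) R2(4) H1(2) H2(2) fellow_sym
    unfolding limit_of_def by blast
qed

text \<open>The vertex \<open>x\<close> is taken on \<open>R1\<close>, so that all paths from \<open>R1\<close> to \<open>R2\<close> stay within the part of the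
digraph that can be reached from \<open>x\<close>. If \<open>R2\<close> is an anti-ray, then paths from \<open>R1\<close> to far
vertices of \<open>R2\<close> and a path from \<open>R2\<close> to \<open>R1\<close> make \<open>x\<close> strongly connected to a tail of \<open>R2\<close>.\<close>
lemma ray_linked_imp_close:
  assumes fin: "\<And>y. finite (E `` {y})"
    and T: "\<And>x. \<exists>T. finite T \<and> (\<forall>H\<in>T. geo_ray E x H) \<and> (\<forall>G. geo_ray E x G \<longrightarrow> (\<exists>H\<in>T. often_near E H G))"
    and R1: "qg_ray E R1" and R2: "qg_ray E R2 \<or> qg_ray (E\<inverse>) R2"
    and link: "linked E R1 R2" "linked E R2 R1"
  shows "close E R1 R2 \<and> close E R2 R1"
proof -
  have edge1: "(R1 i, R1 (Suc i)) \<in> E" for i using R1 by (simp add: qg_ray_def)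
  have up1: "reach (R1 i) (R1 j)" if "i \<le> j" for i j
    using near_imp_reach[OF near_walk[of i j R1 E]] edge1 that by auto
  have restr: "(u, v) \<in> E\<^sup>*" if "(u, v) \<in> (E \<inter> (- F) \<times> (- F))\<^sup>*" for u v F
    using that rtrancl_mono[of "E \<inter> (- F) \<times> (- F)" E] by blast
  have inj: "inj R1" "inj R2" using R1 R2 by (auto simp: qg_ray_def)
  have adj1: "(R1 i, R1 (Suc i)) \<in> E \<or> (R1 (Suc i), R1 i) \<in> E" for i using edge1 by blast
  have adj2: "(R2 i, R2 (Suc i)) \<in> E \<or> (R2 (Suc i), R2 i) \<in> E" for i
    using R2 by (auto simp: qg_ray_def)
  have "\<exists>x m1 m2. (\<forall>i\<ge>m1. reach x (R1 i)) \<and> (\<forall>i\<ge>m2. reach x (R2 i)) \<and>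
      (\<forall>G. limit_of E x R1 G \<longrightarrow> tracks E x R1 G) \<and> (\<forall>G. limit_of E x R2 G \<longrightarrow> tracks E x R2 G)"
    using R2
  proof
    assume R2: "qg_ray E R2"
    obtain i j where ij: "reach (R1 i) (R2 j)"
      using link(1) restr unfolding linked_def by (meson finite.emptyI)
    have "reach (R1 i) (R2 l)" if "j \<le> l" for l
      using rtrancl_trans[OF ij near_imp_reach[OF near_walk[of j l R2 E]]] R2 that
      by (auto simp: qg_ray_def)
    moreover have "tracks E (R1 i) R1 G" if "limit_of E (R1 i) R1 G" for G
      using qg_ray_tracks_limit[OF R1 _ that, of i] by simp
    moreover have "tracks E (R1 i) R2 G" if "limit_of E (R1 i) R2 G" for G
      using qg_ray_tracks_limit[OF R2 ij that] .
    ultimately show ?thesis using up1 by blast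
  next
    assume R2: "qg_ray (E\<inverse>) R2"
    obtain i m where im: "reach (R2 m) (R1 i)"
      using link(2) restr unfolding linked_def by (meson finite.emptyI)
    have down2: "reach (R2 k) (R2 j)" if "j \<le> k" for j k
      using near_imp_reach[OF near_walk[of j k R2 "E\<inverse>"]] R2 that
      by (auto simp: qg_ray_def rtrancl_converse)
    have all: "reach (R1 i) (R2 j)" for j
    proof -
      have "finite (R1 ` {..i} \<union> R2 ` {..j})" by simp
      then obtain i' j' where *: "R1 i' \<notin> R1 ` {..i} \<union> R2 ` {..j}" "R2 j' \<notin> R1 ` {..i} \<union> R2 ` {..j}"
        "reach (R1 i') (R2 j')"
        using link(1) restr unfolding linked_def by meson
      have "i \<le> i'" using *(1) by (metis UnI1 atMost_iff image_eqI nat_le_linear)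
      moreover have "j \<le> j'" using *(2) by (metis UnI2 atMost_iff image_eqI nat_le_linear)
      ultimately show ?thesis using up1 down2 *(3) rtrancl_trans by metis
    qed
    have "tracks E (R1 i) R1 G" if "limit_of E (R1 i) R1 G" for G
      using qg_ray_tracks_limit[OF R1 _ that, of i] by simp
    moreover have "tracks E (R1 i) R2 G" if "limit_of E (R1 i) R2 G" for G
      using qg_antiray_tracks_limit[OF R2 all im that] .
    ultimately show ?thesis using up1 all by blast
  qed
  then obtain x m1 m2 where x: "\<And>i. m1 \<le> i \<Longrightarrow> reach x (R1 i)" "\<And>i. m2 \<le> i \<Longrightarrow> reach x (R2 i)"
    and tr: "\<And>G. limit_of E x R1 G \<Longrightarrow> tracks E x R1 G" "\<And>G. limit_of E x R2 G \<Longrightarrow> tracks E x R2 G"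
    by blast
  obtain G1 where G1: "limit_of E x R1 G1" using limit_exists[OF fin inj(1) x(1)] by blast
  obtain G2 where G2: "limit_of E x R2 G2" using limit_exists[OF fin inj(2) x(2)] by blast
  obtain S where S: "finite S" "\<And>H. H \<in> S \<Longrightarrow> geo_ray E x H"
    "\<And>G. geo_ray E x G \<Longrightarrow> \<exists>H\<in>S. often_near E H G" using T[of x] by blast
  have cover: "\<exists>H\<in>S. \<forall>N. fellow H G N" if "geo_ray E x G" for G
    using S(3)[OF that] often_near_fellow[OF S(2) that] by blast
  have fel: "fellow G1 G2 N" for N
    by (rule linked_imp_same_limit[OF fin S(1,2) cover inj(1) adj1 x(1) G1 inj(2) adj2 x(2) G2 link(1)])
  have geo: "geo_ray E x G1" "geo_ray E x G2" using G1 G2 by (simp_all add: limit_of_def)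
  show ?thesis
    using close_via_limits[OF geo fel tr(1)[OF G1] tr(2)[OF G2]]
      close_via_limits[OF geo(2,1) fellow_sym[OF fel] tr(2)[OF G2] tr(1)[OF G1]] by blast
qed

text \<open>For two anti-rays, paths from \<open>R1\<close> to \<open>R2\<close> need not be reachable from a common vertex, but they all
lead to the first vertex of \<open>R2\<close>; so the edges are reversed.\<close>
lemma linked_imp_close:
  assumes fin: "\<And>y. finite (E `` {y})" "\<And>y. finite (E\<inverse> `` {y})"
    and T: "\<And>x. \<exists>T. finite T \<and> (\<forall>H\<in>T. geo_ray E x H) \<and> (\<forall>G. geo_ray E x G \<longrightarrow> (\<exists>H\<in>T. often_near E H G))"
      "\<And>x. \<exists>T. finite T \<and> (\<forall>H\<in>T. geo_ray (E\<inverse>) x H) \<and>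
        (\<forall>G. geo_ray (E\<inverse>) x G \<longrightarrow> (\<exists>H\<in>T. often_near (E\<inverse>) H G))"
    and R: "qg_ray E R1 \<or> qg_ray (E\<inverse>) R1" "qg_ray E R2 \<or> qg_ray (E\<inverse>) R2"
    and link: "linked E R1 R2" "linked E R2 R1"
  shows "close E R1 R2"
proof -
  consider "qg_ray E R1" | "qg_ray E R2" | "qg_ray (E\<inverse>) R1" "qg_ray (E\<inverse>) R2" using R by blast
  then show ?thesis
  proof cases
    case 1
    then show ?thesis using ray_linked_imp_close[OF fin(1) T(1) 1 R(2) link] by blast
  next
    case 2
    then show ?thesis using ray_linked_imp_close[OF fin(1) T(1) 2 R(1) link(2,1)] by blast
  next
    case 3
    have "linked (E\<inverse>) R1 R2" "linked (E\<inverse>) R2 R1" using link by (simp_all add: linked_converse)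
    then show ?thesis
      using thin_digraph.ray_linked_imp_close[OF reversed fin(2) T(2) 3(1) _, of R2] 3(2)
      by (simp add: close_converse)
  qed
qed

end

section \<open>Walks, distances and hyperbolicity of a digraph\<close>

lemma set_vwalk_arcs: "set (vwalk_arcs p) = {(p ! i, p ! Suc i) | i. Suc i < length p}"
proof (induction p rule: vwalk_arcs.induct)
  case (3 x y xs)
  have "{((x # y # xs) ! i, (x # y # xs) ! Suc i) | i. Suc i < length (x # y # xs)} =
      insert (x, y) {((y # xs) ! i, (y # xs) ! Suc i) | i. Suc i < length (y # xs)}" (is "?L = ?R")
  proof
    show "?L \<subseteq> ?R"
    proof
      fix e assume "e \<in> ?L"
      then obtain i where i: "e = ((x # y # xs) ! i, (x # y # xs) ! Suc i)" "Suc i < length (x # y # xs)"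
        by blast
      show "e \<in> ?R" using i by (cases i) auto
    qed
    show "?R \<subseteq> ?L"
    proof
      fix e assume "e \<in> ?R"
      then consider "e = (x, y)" | i where "e = ((y # xs) ! i, (y # xs) ! Suc i)" "Suc i < length (y # xs)"
        by blast
      then show "e \<in> ?L"
      proof cases
        case 1
        then show ?thesis by (intro CollectI exI[of _ 0]) simp
      next
        case 2
        then show ?thesis by (intro CollectI exI[of _ "Suc i"]) simp
      qed
    qed
  qed
  with 3 show ?case by simp
qed auto

text \<open>A walk that is given as a function, turned into a list of vertices.\<close>
lemma dpath_of_walk:
  assumes "wf_digraph D" "w 0 \<in> verts D" "\<And>i. i < n \<Longrightarrow> (w i, w (Suc i)) \<in> arcs_ends D"
  shows "dpath D (w 0) (map w [0..<Suc n]) (w n)" "vwalk_length (map w [0..<Suc n]) = n"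
    "set (map w [0..<Suc n]) = w ` {..n}"
proof -
  show set: "set (map w [0..<Suc n]) = w ` {..n}" by (simp only: set_map set_upt atLeast0LessThan lessThan_Suc_atMost)
  show "vwalk_length (map w [0..<Suc n]) = n" by simp
  have "w i \<in> verts D" if "i \<le> n" for i
    using assms(2) assms(3)[of "i - 1"] that wf_digraph.adj_in_verts(2)[OF assms(1)] by (cases i) auto
  then have "set (map w [0..<Suc n]) \<subseteq> verts D" unfolding set by auto
  moreover have "set (vwalk_arcs (map w [0..<Suc n])) \<subseteq> arcs_ends D"
    unfolding set_vwalk_arcs using assms(3) by (auto simp del: upt_Suc)
  ultimately have "vwalk (map w [0..<Suc n]) D" by (simp add: vwalk_def del: upt_Suc)
  then show "dpath D (w 0) (map w [0..<Suc n]) (w n)"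
    by (simp add: dpath_def hd_map last_map del: upt_Suc)
qed

lemma near_of_dpath:
  assumes "dpath D x P y" "set P \<inter> F = {}"
  shows "x \<in> verts D" "x \<notin> F" "y \<notin> F" "near (arcs_ends D \<inter> (- F) \<times> (- F)) (vwalk_length P) x y"
proof -
  have P: "vwalk P D" "P \<noteq> []" "hd P = x" "last P = y" using assms(1) by (auto simp: dpath_def)
  then show "x \<in> verts D" "x \<notin> F" "y \<notin> F"
    using assms(2) hd_in_set[of P] last_in_set[of P] by (auto simp: vwalk_def simp del: hd_in_set last_in_set)
  have "(P ! i, P ! Suc i) \<in> arcs_ends D \<inter> (- F) \<times> (- F)" if "i < length P - 1" for i
  proof -
    have "(P ! i, P ! Suc i) \<in> set (vwalk_arcs P)" "P ! i \<in> set P" "P ! Suc i \<in> set P"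
      using that unfolding set_vwalk_arcs by auto
    then show ?thesis using P(1) assms(2) by (auto simp: vwalk_def)
  qed
  then have "near (arcs_ends D \<inter> (- F) \<times> (- F)) (length P - 1 - 0) (P ! 0) (P ! (length P - 1))"
    by (intro near_walk) auto
  then show "near (arcs_ends D \<inter> (- F) \<times> (- F)) (vwalk_length P) x y"
    using P(2-4) by (simp add: hd_conv_nth last_conv_nth)
qed

lemma ddist_eq:
  assumes "wf_digraph D"
  shows "ddist D x y = (if x \<in> verts D \<and> (x, y) \<in> (arcs_ends D)\<^sup>*
    then ereal (real (gdist (arcs_ends D) x y)) else \<infinity>)"
proof -
  let ?E = "arcs_ends D"
  have dist_le: "(x, y) \<in> ?E\<^sup>* \<and> x \<in> verts D \<and> gdist ?E x y \<le> vwalk_length P" if "dpath D x P y" for P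
    using near_of_dpath[OF that, of "{}"] by (simp add: near_iff)
  show ?thesis
  proof (cases "x \<in> verts D \<and> (x, y) \<in> ?E\<^sup>*")
    case True
    obtain w where w: "w 0 = x" "w (gdist ?E x y) = y" "\<And>i. i < gdist ?E x y \<Longrightarrow> (w i, w (Suc i)) \<in> ?E"
      using relpow_walk[OF gdist_relpow[of x y ?E]] True by blast
    let ?P = "map w [0..<Suc (gdist ?E x y)]"
    have P: "dpath D x ?P y" "vwalk_length ?P = gdist ?E x y"
      using dpath_of_walk(1,2)[of D w "gdist ?E x y", OF assms _ w(3)] True unfolding w(1,2) by blast+
    have "ddist D x y \<le> ereal (real (vwalk_length ?P))"
      unfolding ddist_def by (rule INF_lower) (rule CollectI, rule P(1))
    then have "ddist D x y \<le> ereal (real (gdist ?E x y))" unfolding P(2) .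
    moreover have "ereal (real (gdist ?E x y)) \<le> ddist D x y"
      unfolding ddist_def by (rule INF_greatest) (use dist_le in auto)
    ultimately show ?thesis using True by simp
  next
    case False
    then have "{P. dpath D x P y} = {}" using dist_le by blast
    then show ?thesis unfolding ddist_def using False by (simp add: top_ereal_def)
  qed
qed

lemma ddist_le_iff:
  assumes "wf_digraph D"
  shows "ddist D x y \<le> ereal r \<longleftrightarrow>
    x \<in> verts D \<and> (x, y) \<in> (arcs_ends D)\<^sup>* \<and> real (gdist (arcs_ends D) x y) \<le> r"
  by (auto simp: ddist_eq[OF assms])

lemma reach_in_verts:
  assumes "wf_digraph D" "(x, y) \<in> (arcs_ends D)\<^sup>*" "x \<noteq> y"
  shows "x \<in> verts D" "y \<in> verts D"
  using assms(2,3) wf_digraph.adj_in_verts[OF assms(1)]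
  by (metis converse_rtranclE, metis rtranclE)

lemma near_imp_ball:
  assumes "wf_digraph D" "near (arcs_ends D) k x y" "x \<in> verts D"
  shows "y \<in> out_ball D (real k) x" "x \<in> in_ball D (real k) y"
proof -
  have "y \<in> verts D" using reach_in_verts[OF assms(1) near_imp_reach[OF assms(2)]] assms(3) by blast
  then show "y \<in> out_ball D (real k) x" "x \<in> in_ball D (real k) y"
    using assms by (auto simp: out_ball_def in_ball_def ddist_le_iff near_iff)
qed

lemma ball_imp_near:
  assumes "wf_digraph D"
  shows "y \<in> out_ball D r x \<Longrightarrow> near (arcs_ends D) (nat \<lceil>r\<rceil>) x y"
    "y \<in> in_ball D r x \<Longrightarrow> near (arcs_ends D) (nat \<lceil>r\<rceil>) y x"
  using assms by (auto simp: out_ball_def in_ball_def ddist_le_iff near_iff) linarith+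

lemma locally_finite_arcs:
  assumes "wf_digraph D" "locally_finite D"
  shows "finite (arcs_ends D `` {x})" "finite ((arcs_ends D)\<inverse> `` {x})"
proof -
  let ?S = "{y \<in> verts D. ddist D x y = 1 \<or> ddist D y x = 1}"
  have edge: "ddist D u v = 1" if "(u, v) \<in> arcs_ends D" "u \<noteq> v" for u v
  proof -
    have "near (arcs_ends D) 1 u v" using near_edge[OF that(1)] by simp
    moreover have "gdist (arcs_ends D) u v \<noteq> 0" using gdist_eq_0D[OF r_into_rtrancl[OF that(1)]] that(2) by blast
    ultimately have "gdist (arcs_ends D) u v = 1" by (simp add: near_iff)
    then show ?thesis
      using that wf_digraph.adj_in_verts[OF assms(1) that(1)] by (simp add: ddist_eq[OF assms(1)] one_ereal_def)
  qed
  have sub: "arcs_ends D `` {x} \<subseteq> insert x ?S" "(arcs_ends D)\<inverse> `` {x} \<subseteq> insert x ?S"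
    using edge wf_digraph.adj_in_verts[OF assms(1)] by auto
  show "finite (arcs_ends D `` {x})" "finite ((arcs_ends D)\<inverse> `` {x})"
  proof (cases "x \<in> verts D", goal_cases)
    case 1
    then have "finite (insert x ?S)" using assms(2) by (simp add: locally_finite_def)
    then show ?case using sub(1) by (rule finite_subset[rotated])
  next
    case 2
    then have "arcs_ends D `` {x} = {}" using wf_digraph.adj_in_verts[OF assms(1)] by blast
    then show ?case by simp
  next
    case 3
    show ?case
    proof (cases "x \<in> verts D")
      case True
      then have "finite (insert x ?S)" using assms(2) by (simp add: locally_finite_def)
      then show ?thesis using sub(2) by (rule finite_subset[rotated])
    next
      case False
      then have "(arcs_ends D)\<inverse> `` {x} = {}" using wf_digraph.adj_in_verts[OF assms(1)] by blast
      then show ?thesis by simp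
    qed
  qed
qed

lemma geodesic_of_geo:
  assumes "wf_digraph D" "geo (arcs_ends D) x y A" "x \<in> verts D"
  shows "\<exists>P. geodesic D x P y \<and> set P = A \<and> hd P = x \<and> last P = y"
proof -
  let ?E = "arcs_ends D" and ?n = "gdist (arcs_ends D) x y"
  obtain w where w: "w 0 = x" "w ?n = y" "\<And>i. i < ?n \<Longrightarrow> (w i, w (Suc i)) \<in> ?E" "A = w ` {..?n}"
    using assms(2) unfolding geo_def by blast
  have P: "dpath D x (map w [0..<Suc ?n]) y"
    using dpath_of_walk(1)[OF assms(1), of w ?n] w assms(3) by simp
  have "ddist D x y = ereal (real ?n)"
    using geo_reach[OF assms(2)] assms(3) by (simp add: ddist_eq[OF assms(1)])
  then have "geodesic D x (map w [0..<Suc ?n]) y"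
    using P by (simp add: geodesic_def)
  moreover have "set (map w [0..<Suc ?n]) = A"
    unfolding w(4) by (simp only: set_map set_upt atLeast0LessThan lessThan_Suc_atMost)
  ultimately show ?thesis using P unfolding dpath_def by blast
qed

lemma thin_sidesD:
  assumes "wf_digraph D" "thin_sides D \<delta> A B C" "mset [P, Q, R] = mset [A, B, C]"
    and "hd P \<in> {hd Q, last Q}" "last P \<in> {hd R, last R}" "p \<in> set P"
  shows "(\<exists>q\<in>set Q. near (arcs_ends D) (nat \<lceil>\<delta>\<rceil>) q p) \<or> (\<exists>r\<in>set R. near (arcs_ends D) (nat \<lceil>\<delta>\<rceil>) p r)"
proof -
  have "set P \<subseteq> (\<Union>q\<in>set Q. out_ball D \<delta> q) \<union> (\<Union>r\<in>set R. in_ball D \<delta> r)"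
    by (rule assms(2)[unfolded thin_sides_def, rule_format, OF conjI[OF assms(3) conjI[OF assms(4,5)]]])
  then show ?thesis using assms(6) ball_imp_near[OF assms(1)] by blast
qed

text \<open>A vertex of the ambient type outside of the digraph reaches only itself, so triangles at such a
vertex are trivial and the properties hold on the whole type.\<close>
lemma hyperbolic_imp_thin_digraph:
  assumes "wf_digraph D" "hyperbolic D" "B1 D" "B2 D"
  shows "\<exists>\<delta> \<beta>. thin_digraph (arcs_ends D) \<delta> \<beta>"
proof -
  let ?E = "arcs_ends D"
  obtain \<delta> where \<delta>: "\<And>x y z A B C. geodesic_triangle D x y z A B C \<Longrightarrow> thin_sides D \<delta> A B C"
    using assms(2) unfolding hyperbolic_def by blast
  define k where "k = nat \<lceil>\<delta>\<rceil>"
  obtain f1 where f1: "\<And>x r y z. x \<in> verts D \<Longrightarrow> r \<ge> 0 \<Longrightarrow> y \<in> out_ball D r x \<Longrightarrow> z \<in> out_ball D r x \<Longrightarrow>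
      ddist D y z = \<infinity> \<or> ddist D y z \<le> ereal (f1 r)"
    using assms(3) unfolding B1_def by blast
  obtain f2 where f2: "\<And>x r y z. x \<in> verts D \<Longrightarrow> r \<ge> 0 \<Longrightarrow> y \<in> in_ball D r x \<Longrightarrow> z \<in> in_ball D r x \<Longrightarrow>
      ddist D y z = \<infinity> \<or> ddist D y z \<le> ereal (f2 r)"
    using assms(4) unfolding B2_def by blast
  define \<beta> where "\<beta> = max (nat \<lceil>f1 (real (Suc k))\<rceil>) (nat \<lceil>f2 (real (Suc k))\<rceil>)"
  have bounded: "near ?E \<beta> y z"
    if "(y, z) \<in> ?E\<^sup>*" "ddist D y z = \<infinity> \<or> ddist D y z \<le> ereal s" "nat \<lceil>s\<rceil> \<le> \<beta>" for y z s
  proof (cases "y = z")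
    case False
    then have "ddist D y z = ereal (real (gdist ?E y z))"
      using that(1) reach_in_verts[OF assms(1) that(1)] by (simp add: ddist_eq[OF assms(1)])
    then have "real (gdist ?E y z) \<le> s" using that(2) by simp
    then have "gdist ?E y z \<le> nat \<lceil>s\<rceil>" by linarith
    then show ?thesis using that(1,3) unfolding near_iff by (blast intro: order_trans)
  qed simp
  have "geo ?E x y A \<Longrightarrow> geo ?E y z B \<Longrightarrow> geo ?E x z C \<Longrightarrow>
      (\<forall>a\<in>A. (\<exists>c\<in>C. near ?E k c a) \<or> (\<exists>b\<in>B. near ?E k a b)) \<and>
      (\<forall>b\<in>B. (\<exists>a\<in>A. near ?E k a b) \<or> (\<exists>c\<in>C. near ?E k b c)) \<and>
      (\<forall>c\<in>C. (\<exists>a\<in>A. near ?E k a c) \<or> (\<exists>b\<in>B. near ?E k c b))" for x y z A B C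
  proof (cases "x \<in> verts D")
    case True
    assume geo: "geo ?E x y A" "geo ?E y z B" "geo ?E x z C"
    have verts: "y \<in> verts D" "z \<in> verts D"
      using reach_in_verts(2)[OF assms(1) geo_reach[OF geo(1)]]
        reach_in_verts(2)[OF assms(1) geo_reach[OF geo(3)]] True by blast+
    obtain P where P: "geodesic D x P y" "set P = A" "hd P = x" "last P = y"
      using geodesic_of_geo[OF assms(1) geo(1) True] by blast
    obtain Q where Q: "geodesic D y Q z" "set Q = B" "hd Q = y" "last Q = z"
      using geodesic_of_geo[OF assms(1) geo(2) verts(1)] by blast
    obtain R where R: "geodesic D x R z" "set R = C" "hd R = x" "last R = z"
      using geodesic_of_geo[OF assms(1) geo(3) True] by blast
    have "geodesic_triangle D x y z P Q R"
      using True verts P(1) Q(1) R(1) by (simp add: geodesic_triangle_def)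
    note thin = thin_sidesD[OF assms(1) \<delta>[OF this], folded k_def]
    show ?thesis
      using thin[of P R Q] thin[of Q P R] thin[of R P Q] P(2-4) Q(2-4) R(2-4)
      by (simp add: add_mset_commute)
  next
    case False
    assume geo: "geo ?E x y A" "geo ?E y z B" "geo ?E x z C"
    have "y = x" "z = x"
      using reach_in_verts(1)[OF assms(1) geo_reach[OF geo(1)]]
        reach_in_verts(1)[OF assms(1) geo_reach[OF geo(3)]] False by blast+
    then have "A = {x}" "B = {x}" "C = {x}"
      using geo geo_subset_interval[of ?E x x] geo_ends(1)[of ?E x x] by (simp_all add: subset_singleton_iff) blast+
    then show ?thesis by simp
  qed
  note thin = this
  have out: "near ?E \<beta> y z" if "near ?E (Suc k) x y" "near ?E (Suc k) x z" "(y, z) \<in> ?E\<^sup>*" for x y z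
  proof (cases "x \<in> verts D")
    case True
    have "nat \<lceil>f1 (real (Suc k))\<rceil> \<le> \<beta>" by (simp add: \<beta>_def)
    then show ?thesis
      using bounded[OF that(3) f1[OF True of_nat_0_le_iff near_imp_ball(1)[OF assms(1) that(1) True]
            near_imp_ball(1)[OF assms(1) that(2) True]]] by blast
  next
    case False
    then have "y = x" "z = x"
      using reach_in_verts(1)[OF assms(1) near_imp_reach[OF that(1)]]
        reach_in_verts(1)[OF assms(1) near_imp_reach[OF that(2)]] False by blast+
    then show ?thesis by simp
  qed
  have inn: "near ?E \<beta> y z" if "near ?E (Suc k) y x" "near ?E (Suc k) z x" "(y, z) \<in> ?E\<^sup>*" for x y z
  proof (cases "x \<in> verts D")
    case True
    have "y \<in> verts D" "z \<in> verts D"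
      using reach_in_verts(1)[OF assms(1) near_imp_reach[OF that(1)]]
        reach_in_verts(1)[OF assms(1) near_imp_reach[OF that(2)]] True by blast+
    moreover have "nat \<lceil>f2 (real (Suc k))\<rceil> \<le> \<beta>" by (simp add: \<beta>_def)
    ultimately show ?thesis
      using bounded[OF that(3) f2[OF True of_nat_0_le_iff near_imp_ball(2)[OF assms(1) that(1)]
            near_imp_ball(2)[OF assms(1) that(2)]]] by blast
  next
    case False
    then have "y = x" "z = x"
      using reach_in_verts(2)[OF assms(1) near_imp_reach[OF that(1)]]
        reach_in_verts(2)[OF assms(1) near_imp_reach[OF that(2)]] False by blast+
    then show ?thesis by simp
  qed
  have "thin_digraph ?E k \<beta>"
    by unfold_locales (use thin out inn in blast)+
  then show ?thesis by blast
qed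

section \<open>Rays and ends of a digraph\<close>

lemma geo_walk_dist_between:
  assumes "geo_walk E x g n" "i \<le> j" "j \<le> n"
  shows "gdist E (g i) (g j) = j - i"
proof -
  have "gdist E (g i) (g j) \<le> j - i" using geo_walk_near[OF assms] by (simp add: near_iff)
  moreover have "gdist E x (g j) \<le> gdist E x (g i) + gdist E (g i) (g j)"
    using geo_walk_reach[OF assms(1), of i] near_imp_reach[OF geo_walk_near[OF assms]] assms(2,3)
    by (intro gdist_triangle) auto
  ultimately show ?thesis
    using geo_walk_dist[OF assms(1), of i] geo_walk_dist[OF assms(1,3)] assms(2,3) by simp
qed

lemma geo_ray_edge: "geo_ray E x G \<Longrightarrow> (G i, G (Suc i)) \<in> E"
  unfolding geo_ray_def geo_walk_def by (metis lessI)

lemma geo_ray_reach: "geo_ray E x G \<Longrightarrow> i \<le> j \<Longrightarrow> (G i, G j) \<in> E\<^sup>*"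
  using near_imp_reach[OF geo_walk_near[of E x G j i j]] by (simp add: geo_ray_def)

lemma geo_ray_dist: "geo_ray E x G \<Longrightarrow> i \<le> j \<Longrightarrow> gdist E (G i) (G j) = j - i"
  using geo_walk_dist_between[of E x G j i j] by (simp add: geo_ray_def)

lemma geo_ray_start: "geo_ray E x G \<Longrightarrow> G 0 = x"
  unfolding geo_ray_def geo_walk_def by blast

lemma geo_ray_level:
  assumes "geo_ray E x G" shows "gdist E x (G n) = n" "(x, G n) \<in> E\<^sup>*"
  using geo_ray_dist[OF assms, of 0 n] geo_ray_reach[OF assms, of 0 n] geo_ray_start[OF assms] by auto

lemma geo_ray_inj: "geo_ray E x G \<Longrightarrow> inj G"
  by (rule injI) (metis geo_ray_level(1))

lemma sublist_map_upt_ends: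
  assumes "sublist Q (map R [i..<j])" "Q \<noteq> []"
  shows "\<exists>a. hd Q = R a \<and> last Q = R (a + (length Q - 1))"
proof -
  obtain ps ss where eq: "map R [i..<j] = ps @ Q @ ss" using assms unfolding sublist_def by blast
  have len: "length ps + length Q \<le> j - i" using arg_cong[OF eq, of length] by simp
  have "Q ! k = R (i + length ps + k)" if "k < length Q" for k
  proof -
    have "(ps @ Q @ ss) ! (length ps + k) = Q ! k" using that by (simp add: nth_append)
    then have "map R [i..<j] ! (length ps + k) = Q ! k" using eq by simp
    then show ?thesis using len that by (simp add: add.assoc)
  qed
  from this[of 0] this[of "length Q - 1"] show ?thesis
    using assms(2) by (intro exI[of _ "i + length ps"]) (simp add: hd_conv_nth last_conv_nth)
qed

lemma ends_in_verts:
  assumes "wf_digraph D" "\<And>i. (R i, R (Suc i)) \<in> arcs_ends D \<or> (R (Suc i), R i) \<in> arcs_ends D"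
  shows "R i \<in> verts D"
  using assms(2)[of i] wf_digraph.adj_in_verts[OF assms(1)] by blast

lemma rays_adjacent:
  "R \<in> rays D \<Longrightarrow> (R i, R (Suc i)) \<in> arcs_ends D \<or> (R (Suc i), R i) \<in> arcs_ends D"
  by (auto simp: rays_def is_ray_def is_antiray_def)

lemma rays_in_verts: "wf_digraph D \<Longrightarrow> R \<in> rays D \<Longrightarrow> R i \<in> verts D"
  using ends_in_verts[of D R i] rays_adjacent[of R D] by blast

lemma qg_rays_subset_rays: "qg_rays D \<subseteq> rays D"
  by (auto simp: qg_rays_def rays_def)

lemma qg_bound_from_quasi_geodesic:
  assumes "wf_digraph D" "quasi_geodesic D \<gamma> c P" "(hd P, last P) \<in> (arcs_ends D)\<^sup>*"
    and "hd P \<in> verts D" "0 \<le> \<gamma>"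
  shows "vwalk_length P \<le> nat \<lceil>\<gamma>\<rceil> * gdist (arcs_ends D) (hd P) (last P) + nat \<lceil>c\<rceil>"
proof -
  let ?d = "gdist (arcs_ends D) (hd P) (last P)"
  have "P \<noteq> []" "sublist P P" using assms(2) by (auto simp: quasi_geodesic_def vwalk_def)
  then have "ereal (real (vwalk_length P)) \<le> ereal \<gamma> * ddist D (hd P) (last P) + ereal c"
    using assms(2) unfolding quasi_geodesic_def by blast
  then have "real (vwalk_length P) \<le> \<gamma> * real ?d + c"
    using assms(3,4) by (simp add: ddist_eq[OF assms(1)] del: vwalk_length_simp)
  also have "\<dots> \<le> real (nat \<lceil>\<gamma>\<rceil>) * real ?d + real (nat \<lceil>c\<rceil>)"
    by (intro add_mono mult_right_mono) (auto simp: real_nat_ceiling_ge)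
  finally have "real (vwalk_length P) \<le> real (nat \<lceil>\<gamma>\<rceil> * ?d + nat \<lceil>c\<rceil>)" by simp
  then show ?thesis by (simp only: of_nat_le_iff)
qed

lemma qg_rays_imp_qg_ray:
  assumes "wf_digraph D" "R \<in> qg_rays D"
  shows "qg_ray (arcs_ends D) R \<or> qg_ray ((arcs_ends D)\<inverse>) R"
proof -
  let ?E = "arcs_ends D"
  have verts: "R i \<in> verts D" for i
    using rays_in_verts[OF assms(1)] assms(2) qg_rays_subset_rays by blast
  have ends: "hd (map R [i..<Suc j]) = R i" "last (map R [i..<Suc j]) = R j"
      "vwalk_length (map R [i..<Suc j]) = j - i" "map R [i..<Suc j] \<noteq> []"
      "vwalk_length (rev (map R [i..<Suc j])) = j - i" if "i \<le> j" for i j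
    using that by (simp_all add: hd_map last_map del: upt_Suc)
  consider \<gamma> c where "is_ray D R" "\<gamma> \<ge> 1" "\<And>i j. i \<le> j \<Longrightarrow> quasi_geodesic D \<gamma> c (map R [i..<Suc j])"
    | \<gamma> c where "is_antiray D R" "\<gamma> \<ge> 1" "\<And>i j. i \<le> j \<Longrightarrow> quasi_geodesic D \<gamma> c (rev (map R [i..<Suc j]))"
    using assms(2) unfolding qg_rays_def by blast
  then show ?thesis
  proof cases
    case 1
    have "j - i \<le> nat \<lceil>\<gamma>\<rceil> * gdist ?E (R i) (R j) + nat \<lceil>c\<rceil>" if "i \<le> j" for i j
    proof -
      have "(R i, R j) \<in> ?E\<^sup>*"
        using near_imp_reach[OF near_walk[of i j R ?E]] 1(1) that by (auto simp: is_ray_def)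
      then show ?thesis
        using qg_bound_from_quasi_geodesic[OF assms(1) 1(3)[OF that]] verts 1(2)
        unfolding ends[OF that] by simp
    qed
    then show ?thesis using 1(1) unfolding qg_ray_def is_ray_def by blast
  next
    case 2
    have "j - i \<le> nat \<lceil>\<gamma>\<rceil> * gdist (?E\<inverse>) (R i) (R j) + nat \<lceil>c\<rceil>" if "i \<le> j" for i j
    proof -
      have "(R i, R j) \<in> (?E\<inverse>)\<^sup>*"
        using near_imp_reach[OF near_walk[of i j R "?E\<inverse>"]] 2(1) that by (auto simp: is_antiray_def)
      then have "(R j, R i) \<in> ?E\<^sup>*" by (simp add: rtrancl_converse)
      then show ?thesis
        using qg_bound_from_quasi_geodesic[OF assms(1) 2(3)[OF that]] verts 2(2)
        unfolding hd_rev last_rev ends[OF that] gdist_converse by simp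
    qed
    then show ?thesis using 2(1) unfolding qg_ray_def is_antiray_def by blast
  qed
qed

lemma geo_ray_imp_qg_rays:
  assumes "wf_digraph D" "geo_ray (arcs_ends D) x G"
  shows "G \<in> qg_rays D"
proof -
  have edge: "(G i, G (Suc i)) \<in> arcs_ends D" for i using geo_ray_edge[OF assms(2)] .
  have verts: "G i \<in> verts D" for i using ends_in_verts[of D G i] assms(1) edge by blast
  have walk: "vwalk (map G [i..<Suc j]) D" if "i \<le> j" for i j
  proof -
    have "map (\<lambda>l. G (i + l)) [0..<Suc (j - i)] = map G [i..<Suc j]"
      using that by (intro nth_equalityI) (auto simp: Suc_diff_le simp del: upt_Suc)
    then show ?thesis
      using dpath_of_walk(1)[OF assms(1), of "\<lambda>l. G (i + l)" "j - i"] edge verts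
      by (simp add: dpath_def del: upt_Suc)
  qed
  have "quasi_geodesic D 1 0 (map G [i..<Suc j])" if "i \<le> j" for i j
    unfolding quasi_geodesic_def
  proof (intro conjI allI impI)
    fix Q assume Q: "sublist Q (map G [i..<Suc j]) \<and> Q \<noteq> []"
    then obtain a where a: "hd Q = G a" "last Q = G (a + (length Q - 1))"
      using sublist_map_upt_ends[of Q G i "Suc j"] by blast
    then have "ddist D (hd Q) (last Q) = ereal (real (vwalk_length Q))"
      using geo_ray_dist[OF assms(2), of a "a + (length Q - 1)"]
        geo_ray_reach[OF assms(2), of a "a + (length Q - 1)"] verts
      by (simp add: ddist_eq[OF assms(1)])
    then show "ereal (real (vwalk_length Q)) \<le> ereal 1 * ddist D (hd Q) (last Q) + ereal 0" by simp
  qed (rule walk[OF that])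
  then have "\<exists>\<gamma>\<ge>1. \<exists>c\<ge>0. \<forall>i j. i \<le> j \<longrightarrow> quasi_geodesic D \<gamma> c (map G [i..<Suc j])"
    using order_refl[of "1::real"] order_refl[of "0::real"] by blast
  moreover have "is_ray D G" using edge geo_ray_inj[OF assms(2)] by (simp add: is_ray_def)
  ultimately show ?thesis unfolding qg_rays_def by blast
qed

lemma geo_antiray_imp_qg_rays:
  assumes "wf_digraph D" "geo_ray ((arcs_ends D)\<inverse>) x G"
  shows "G \<in> qg_rays D"
proof -
  have edge: "(G (Suc i), G i) \<in> arcs_ends D" for i using geo_ray_edge[OF assms(2)] by simp
  have verts: "G i \<in> verts D" for i using ends_in_verts[of D G i] assms(1) edge by blast
  have walk: "vwalk (rev (map G [i..<Suc j])) D" if "i \<le> j" for i j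
  proof -
    have "rev (map G [i..<Suc j]) = map (\<lambda>l. G (j - l)) [0..<Suc (j - i)]"
      using that by (intro nth_equalityI) (auto simp: rev_nth simp del: upt_Suc)
    moreover have "(G (j - l), G (j - Suc l)) \<in> arcs_ends D" if "l < j - i" for l
      using edge[of "j - Suc l"] that by (simp add: Suc_diff_Suc)
    ultimately show ?thesis
      using dpath_of_walk(1)[OF assms(1), of "\<lambda>l. G (j - l)" "j - i"] verts
      by (simp add: dpath_def del: upt_Suc)
  qed
  have "quasi_geodesic D 1 0 (rev (map G [i..<Suc j]))" if "i \<le> j" for i j
    unfolding quasi_geodesic_def
  proof (intro conjI allI impI)
    fix Q assume Q: "sublist Q (rev (map G [i..<Suc j])) \<and> Q \<noteq> []"
    then have "sublist (rev Q) (map G [i..<Suc j])"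
      using sublist_rev[of "rev Q" "map G [i..<Suc j]"] by simp
    then obtain a where a: "last Q = G a" "hd Q = G (a + (length Q - 1))"
      using sublist_map_upt_ends[of "rev Q" G i "Suc j"] Q by (auto simp: hd_rev last_rev)
    then have "ddist D (hd Q) (last Q) = ereal (real (vwalk_length Q))"
      using geo_ray_dist[OF assms(2), of a "a + (length Q - 1)"]
        geo_ray_reach[OF assms(2), of a "a + (length Q - 1)"] verts
      by (simp add: ddist_eq[OF assms(1)] gdist_converse rtrancl_converse)
    then show "ereal (real (vwalk_length Q)) \<le> ereal 1 * ddist D (hd Q) (last Q) + ereal 0" by simp
  qed (rule walk[OF that])
  then have "\<exists>\<gamma>\<ge>1. \<exists>c\<ge>0. \<forall>i j. i \<le> j \<longrightarrow> quasi_geodesic D \<gamma> c (rev (map G [i..<Suc j]))"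
    using order_refl[of "1::real"] order_refl[of "0::real"] by blast
  moreover have "is_antiray D G" using edge geo_ray_inj[OF assms(2)] by (simp add: is_antiray_def)
  ultimately show ?thesis unfolding qg_rays_def by blast
qed

lemma finite_balls:
  assumes "wf_digraph D" "locally_finite D"
  shows "finite (out_ball D r x \<union> in_ball D r x)"
proof (rule finite_subset)
  let ?E = "arcs_ends D" and ?k = "nat \<lceil>r\<rceil>"
  show "out_ball D r x \<union> in_ball D r x \<subseteq> {y. near ?E ?k x y} \<union> {y. near (?E\<inverse>) ?k x y}"
    using ball_imp_near[OF assms(1)] by (auto simp: near_converse)
  show "finite ({y. near ?E ?k x y} \<union> {y. near (?E\<inverse>) ?k x y})"
    using finite_ball[of ?E] finite_ball[of "?E\<inverse>"] locally_finite_arcs[OF assms] by blast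
qed

lemma close_imp_qg_le:
  assumes "wf_digraph D" "locally_finite D" "close (arcs_ends D) R1 R2" "range R1 \<subseteq> verts D"
  shows "qg_le D R1 R2"
proof -
  let ?E = "arcs_ends D"
  obtain M where M: "\<And>F. finite F \<Longrightarrow>
      \<exists>i j. R1 i \<notin> F \<and> R2 j \<notin> F \<and> near (?E \<inter> (- F) \<times> (- F)) M (R1 i) (R2 j)"
    using assms(3) unfolding close_def by blast
  have "\<exists>P. path_between D R1 P R2 \<and> real (vwalk_length P) \<le> real M \<and> set P \<inter> F = {}"
    if F: "finite F" for F
  proof -
    obtain i j m where ij: "R1 i \<notin> F" "m \<le> M" "(R1 i, R2 j) \<in> (?E \<inter> (- F) \<times> (- F)) ^^ m"
      using M[OF F] unfolding near_def by blast
    obtain w where w: "w 0 = R1 i" "w m = R2 j" "\<And>l. l < m \<Longrightarrow> (w l, w (Suc l)) \<in> ?E \<inter> (- F) \<times> (- F)"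
      using relpow_walk[OF ij(3)] by blast
    have avoid: "w l \<notin> F" if "l \<le> m" for l
      using that w(1) ij(1) w(3)[of "l - 1"] by (cases l) auto
    have "w 0 \<in> verts D" using w(1) assms(4) by auto
    note P = dpath_of_walk[of D w m, OF assms(1) this]
    have "dpath D (R1 i) (map w [0..<Suc m]) (R2 j)" "vwalk_length (map w [0..<Suc m]) = m"
      "set (map w [0..<Suc m]) \<inter> F = {}"
      using P w avoid by (auto simp del: upt_Suc)
    then show ?thesis using ij(2) unfolding path_between_def
      by (intro exI[of _ "map w [0..<Suc m]"]) (auto simp del: upt_Suc vwalk_length_simp)
  qed
  then show ?thesis
    unfolding qg_le_def using finite_balls[OF assms(1,2)] by (intro exI[of _ "real M"]) simp
qed

text \<open>A path that avoids the balls of radius \<open>N\<close> around \<open>x\<close> starts and ends at vertices of the two rays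
with indices above \<open>N\<close>.\<close>
lemma qg_le_imp_often_near:
  assumes "wf_digraph D" "qg_le D G H"
    and "geo_ray (arcs_ends D) x G \<and> geo_ray (arcs_ends D) x H \<or>
      geo_ray ((arcs_ends D)\<inverse>) x G \<and> geo_ray ((arcs_ends D)\<inverse>) x H"
  shows "often_near (arcs_ends D) G H"
proof -
  let ?E = "arcs_ends D"
  have x: "x \<in> verts D"
    using assms(3) geo_ray_edge[of _ x G 0] geo_ray_start[of _ x G] wf_digraph.adj_in_verts[OF assms(1)]
    by fastforce
  have level: "G i \<in> out_ball D (real N) x \<union> in_ball D (real N) x"
      "H i \<in> out_ball D (real N) x \<union> in_ball D (real N) x" if "i \<le> N" for i N
    using assms(3)
  proof (atomize(full), elim disjE conjE, goal_cases)
    case 1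
    have "near ?E N x (G i)" "near ?E N x (H i)"
      using geo_ray_level[OF 1(1)] geo_ray_level[OF 1(2)] that by (auto simp: near_iff)
    then show ?case using near_imp_ball(1)[OF assms(1) _ x] by blast
  next
    case 2
    have G: "near ?E N (G i) x" and H: "near ?E N (H i) x"
      using geo_ray_level[OF 2(1)] geo_ray_level[OF 2(2)] that
      by (auto simp: near_iff gdist_converse rtrancl_converse)
    have "G i \<in> verts D" "H i \<in> verts D"
      using reach_in_verts(1)[OF assms(1) near_imp_reach[OF G]]
        reach_in_verts(1)[OF assms(1) near_imp_reach[OF H]] x by metis+
    then show ?case using near_imp_ball(2)[OF assms(1) G] near_imp_ball(2)[OF assms(1) H] by blast
  qed
  obtain M where M: "\<And>r. r \<ge> 0 \<Longrightarrow> \<exists>P. path_between D G P H \<and> real (vwalk_length P) \<le> M \<and>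
      set P \<inter> (out_ball D r x \<union> in_ball D r x) = {}"
    using assms(2) x unfolding qg_le_def by blast
  have "\<exists>i\<ge>N. \<exists>j\<ge>N. near ?E (nat \<lceil>M\<rceil>) (G i) (H j)" for N
  proof -
    obtain P i j where P: "dpath D (G i) P (H j)" "real (vwalk_length P) \<le> M"
      "set P \<inter> (out_ball D (real N) x \<union> in_ball D (real N) x) = {}"
      using M[of "real N"] unfolding path_between_def by auto
    note P' = near_of_dpath[OF P(1,3)]
    have "N \<le> i" "N \<le> j" using P'(2,3) level by (metis nat_le_linear)+
    moreover have "near ?E (vwalk_length P) (G i) (H j)"
      using near_of_dpath(4)[OF P(1), of "{}"] by simp
    then have "near ?E (nat \<lceil>M\<rceil>) (G i) (H j)" by (rule near_mono) (use P(2) in linarith)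
    ultimately show ?thesis by blast
  qed
  then show ?thesis unfolding often_near_def by blast
qed

lemma often_near_converse: "often_near (E\<inverse>) R1 R2 \<longleftrightarrow> often_near E R2 R1"
proof -
  have "(\<exists>i\<ge>N. \<exists>j\<ge>N. near (E\<inverse>) M (R1 i) (R2 j)) \<longleftrightarrow> (\<exists>i\<ge>N. \<exists>j\<ge>N. near E M (R2 i) (R1 j))" for M N
    unfolding near_converse by blast
  then show ?thesis by (simp add: often_near_def)
qed

lemma escaping_ray_qg_le_self:
  assumes "wf_digraph D" "locally_finite D" "inj R" "range R \<subseteq> verts D"
  shows "qg_le D R R"
proof (rule close_imp_qg_le[OF assms(1,2) _ assms(4)])
  have "\<exists>i. R i \<notin> F" if "finite F" for F
    using that assms(3) finite_vimageI[of F R] by (metis ex_new_if_finite infinite_UNIV_nat vimageI2)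
  then show "close (arcs_ends D) R R"
    unfolding close_def by (metis near_refl)
qed

text \<open>Choose one ray from each class that meets \<open>S\<close>. By reflexivity \<open>G\<close> belongs to its own class, which
is also the class of its representative \<open>H\<close>.\<close>
lemma finitely_many_geodesic_rays:
  assumes "wf_digraph D" "locally_finite D" "finite (qg_boundary D)"
    and S: "S \<subseteq> qg_rays D"
  shows "\<exists>T. finite T \<and> T \<subseteq> S \<and> (\<forall>G\<in>S. \<exists>H\<in>T. qg_le D H G \<and> qg_le D G H)"
proof -
  let ?c = "\<lambda>R. qg_rel D `` {R}"
  have "?c ` S \<subseteq> qg_boundary D" using S by (auto simp: qg_boundary_def quotient_def)
  then have "finite (?c ` S)" using assms(3) by (rule finite_subset)
  from finite_subset_image[OF this order_refl]
  obtain T where T: "T \<subseteq> S" "finite T" "?c ` S = ?c ` T" by blast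
  have "\<exists>H\<in>T. qg_le D H G \<and> qg_le D G H" if G: "G \<in> S" for G
  proof -
    have "?c G \<in> ?c ` T" using imageI[OF G, of ?c] unfolding T(3) .
    then obtain H where H: "H \<in> T" "?c G = ?c H" by (elim imageE) (rule that)
    have ray: "G \<in> rays D" using G S qg_rays_subset_rays by blast
    then have "inj G" by (auto simp: rays_def is_ray_def is_antiray_def)
    moreover have "range G \<subseteq> verts D" using rays_in_verts[OF assms(1) ray] by blast
    ultimately have "qg_le D G G" using escaping_ray_qg_le_self[OF assms(1,2)] by blast
    then have "G \<in> ?c G" using G S by (auto simp: qg_rel_def)
    then have "(H, G) \<in> qg_rel D" using H(2) by simp
    then show ?thesis using H(1) by (auto simp: qg_rel_def)
  qed
  with T(1,2) show ?thesis by blast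
qed

text \<open>Disjoint paths that meet a finite set meet it in different vertices.\<close>
lemma end_le_imp_linked:
  assumes "end_le D R1 R2"
  shows "linked (arcs_ends D) R1 R2"
  unfolding linked_def
proof (intro allI impI)
  fix F :: "'a set" assume F: "finite F"
  obtain \<P> where \<P>: "infinite \<P>" "\<And>P. P \<in> \<P> \<Longrightarrow> path_between D R1 P R2"
    "pairwise (\<lambda>P Q. disjnt (set P) (set Q)) \<P>"
    using assms unfolding end_le_def by blast
  define hit where "hit = {P \<in> \<P>. set P \<inter> F \<noteq> {}}"
  have "\<forall>P\<in>hit. \<exists>v. v \<in> set P \<inter> F" by (auto simp: hit_def)
  then obtain f where f: "\<And>P. P \<in> hit \<Longrightarrow> f P \<in> set P \<inter> F" by metis
  have "inj_on f hit"
  proof (rule inj_onI)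
    fix P Q assume PQ: "P \<in> hit" "Q \<in> hit" "f P = f Q"
    show "P = Q"
    proof (rule ccontr)
      assume "P \<noteq> Q"
      then have "disjnt (set P) (set Q)" using \<P>(3) PQ(1,2) by (auto simp: pairwise_def hit_def)
      then show False using f[OF PQ(1)] f[OF PQ(2)] PQ(3) by (auto simp: disjnt_def)
    qed
  qed
  moreover have "f ` hit \<subseteq> F" using f by blast
  ultimately have "finite hit" using F by (meson inj_on_finite)
  then obtain P where P: "P \<in> \<P>" "P \<notin> hit" using \<P>(1) by (meson finite_subset subsetI)
  then obtain i j where "dpath D (R1 i) P (R2 j)" "set P \<inter> F = {}"
    using \<P>(2)[OF P(1)] unfolding path_between_def hit_def by auto
  from near_of_dpath(2,3)[OF this] near_imp_reach[OF near_of_dpath(4)[OF this]]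
  show "\<exists>i j. R1 i \<notin> F \<and> R2 j \<notin> F \<and>
      (R1 i, R2 j) \<in> (arcs_ends D \<inter> (- F) \<times> (- F))\<^sup>*"
    by blast
qed

lemma end_le_refl:
  assumes "wf_digraph D" "R \<in> rays D"
  shows "end_le D R R"
proof -
  have "inj R" using assms(2) by (auto simp: rays_def is_ray_def is_antiray_def)
  have "R i \<in> verts D" for i using rays_in_verts[OF assms] .
  then have "path_between D R [R i] R" for i
    unfolding path_between_def dpath_def vwalk_def by auto
  moreover have "infinite (range (\<lambda>i. [R i]))"
    using \<open>inj R\<close> by (intro range_inj_infinite) (auto simp: inj_def)
  moreover have "pairwise (\<lambda>P Q. disjnt (set P) (set Q)) (range (\<lambda>i. [R i]))"
    by (auto simp: pairwise_def)
  ultimately show ?thesis unfolding end_le_def by (intro exI[of _ "range (\<lambda>i. [R i])"]) auto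
qed

lemma one_ended_linked:
  assumes "wf_digraph D" "one_ended D" "R1 \<in> rays D" "R2 \<in> rays D"
  shows "linked (arcs_ends D) R1 R2"
proof -
  have "end_rel D `` {R1} \<in> ends D" "end_rel D `` {R2} \<in> ends D"
    using assms(3,4) by (auto simp: ends_def quotient_def)
  then have "end_rel D `` {R1} = end_rel D `` {R2}"
    using assms(2) unfolding one_ended_def is_singleton_def by fastforce
  moreover have "R2 \<in> end_rel D `` {R2}"
    using end_le_refl[OF assms(1,4)] assms(4) by (simp add: end_rel_def)
  ultimately have "(R1, R2) \<in> end_rel D" by blast
  then show ?thesis using end_le_imp_linked by (auto simp: end_rel_def)
qed

lemma qg_rays_nonempty:
  assumes "wf_digraph D" "locally_finite D" "rays D \<noteq> {}"
  shows "qg_rays D \<noteq> {}"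
proof -
  let ?E = "arcs_ends D"
  obtain R where "R \<in> rays D" using assms(3) by blast
  then consider "is_ray D R" | "is_antiray D R" by (auto simp: rays_def)
  then show ?thesis
  proof cases
    case 1
    have reach: "(R 0, R k) \<in> ?E\<^sup>*" for k
      using near_imp_reach[OF near_walk[of 0 k R ?E]] 1 by (simp add: is_ray_def)
    obtain G where "limit_of ?E (R 0) R G"
      using limit_exists[OF locally_finite_arcs(1)[OF assms(1,2)], of R 0 "R 0"] 1 reach
      by (auto simp: is_ray_def)
    then have "geo_ray ?E (R 0) G" by (simp add: limit_of_def)
    from geo_ray_imp_qg_rays[OF assms(1) this] show ?thesis by blast
  next
    case 2
    have reach: "(R 0, R k) \<in> (?E\<inverse>)\<^sup>*" for k
      using near_imp_reach[OF near_walk[of 0 k R "?E\<inverse>"]] 2 by (simp add: is_antiray_def)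
    obtain G where "limit_of (?E\<inverse>) (R 0) R G"
      using limit_exists[OF locally_finite_arcs(2)[OF assms(1,2)], of R 0 "R 0"] 2 reach
      by (auto simp: is_antiray_def)
    then have "geo_ray (?E\<inverse>) (R 0) G" by (simp add: limit_of_def)
    from geo_antiray_imp_qg_rays[OF assms(1) this] show ?thesis by blast
  qed
qed

section \<open>The boundary\<close>

theorem corollary10p7:
  fixes D :: "('a,'b) pre_digraph"
  assumes "wf_digraph D"
    and "one_ended D"
    and "locally_finite D"
    and "hyperbolic D"
    and "B1 D" and "B2 D"
    and "\<exists>S. finite S \<and> is_base D S"
  shows "is_singleton (qg_boundary D) \<or> infinite (qg_boundary D)"
proof (cases "finite (qg_boundary D)")
  case True
  let ?E = "arcs_ends D"
  obtain \<delta> \<beta> where thin: "thin_digraph ?E \<delta> \<beta>"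
    using hyperbolic_imp_thin_digraph[OF assms(1,4,5,6)] by blast
  note fin = locally_finite_arcs[OF assms(1,3)]
  have outward: "\<exists>T. finite T \<and> (\<forall>H\<in>T. geo_ray ?E x H) \<and>
      (\<forall>G. geo_ray ?E x G \<longrightarrow> (\<exists>H\<in>T. often_near ?E H G))" for x
  proof -
    have "{G. geo_ray ?E x G} \<subseteq> qg_rays D" using geo_ray_imp_qg_rays[OF assms(1)] by blast
    from finitely_many_geodesic_rays[OF assms(1,3) True this]
    obtain T where T: "finite T" "T \<subseteq> {G. geo_ray ?E x G}"
      "\<forall>G\<in>{G. geo_ray ?E x G}. \<exists>H\<in>T. qg_le D H G \<and> qg_le D G H"
      by (elim exE conjE) (rule that)
    have "\<exists>H\<in>T. often_near ?E H G" if G: "geo_ray ?E x G" for G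
    proof -
      obtain H where H: "H \<in> T" "qg_le D H G" "qg_le D G H" using bspec[OF T(3), of G] G by blast
      then have "geo_ray ?E x H" using T(2) by blast
      then have "often_near ?E H G" using qg_le_imp_often_near[OF assms(1) H(2)] G by blast
      then show ?thesis using H(1) by blast
    qed
    then show ?thesis using T(1,2) by blast
  qed
  have inward: "\<exists>T. finite T \<and> (\<forall>H\<in>T. geo_ray (?E\<inverse>) x H) \<and>
      (\<forall>G. geo_ray (?E\<inverse>) x G \<longrightarrow> (\<exists>H\<in>T. often_near (?E\<inverse>) H G))" for x
  proof -
    have "{G. geo_ray (?E\<inverse>) x G} \<subseteq> qg_rays D" using geo_antiray_imp_qg_rays[OF assms(1)] by blast
    from finitely_many_geodesic_rays[OF assms(1,3) True this]
    obtain T where T: "finite T" "T \<subseteq> {G. geo_ray (?E\<inverse>) x G}"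
      "\<forall>G\<in>{G. geo_ray (?E\<inverse>) x G}. \<exists>H\<in>T. qg_le D H G \<and> qg_le D G H"
      by (elim exE conjE) (rule that)
    have "\<exists>H\<in>T. often_near (?E\<inverse>) H G" if G: "geo_ray (?E\<inverse>) x G" for G
    proof -
      obtain H where H: "H \<in> T" "qg_le D H G" "qg_le D G H" using bspec[OF T(3), of G] G by blast
      then have "geo_ray (?E\<inverse>) x H" using T(2) by blast
      then have "often_near ?E G H" using qg_le_imp_often_near[OF assms(1) H(3)] G by blast
      then have "often_near (?E\<inverse>) H G" by (simp add: often_near_converse)
      then show ?thesis using H(1) by blast
    qed
    then show ?thesis using T(1,2) by blast
  qed
  have le: "qg_le D R1 R2" if R: "R1 \<in> qg_rays D" "R2 \<in> qg_rays D" for R1 R2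
  proof -
    have rays: "R1 \<in> rays D" "R2 \<in> rays D" using R qg_rays_subset_rays by blast+
    have "close ?E R1 R2"
      using one_ended_linked[OF assms(1,2)] rays
      by (intro thin_digraph.linked_imp_close[OF thin fin outward inward] qg_rays_imp_qg_ray[OF assms(1)] R)
    moreover have "range R1 \<subseteq> verts D" using rays_in_verts[OF assms(1) rays(1)] by blast
    ultimately show ?thesis by (rule close_imp_qg_le[OF assms(1,3)])
  qed
  have "rays D \<noteq> {}"
    using assms(2) by (auto simp: one_ended_def ends_def is_singleton_def quotient_def)
  then have "qg_rays D \<noteq> {}" using qg_rays_nonempty[OF assms(1,3)] by blast
  moreover have "qg_rel D = qg_rays D \<times> qg_rays D" using le by (auto simp: qg_rel_def)
  ultimately have "qg_boundary D = {qg_rays D}" by (auto simp: qg_boundary_def quotient_def)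
  then show ?thesis by simp
qed simp

end
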